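(* There exists an absolute constant $c>0$ such that the following holds. Let $n\ge 1$ be an integer and let $F\in\mathfrak F$ be a distribution represented in the form $$F=(1-p)\,U+p\,V,\qquad U,V\in\mathfrak F,\quad 0<p<1.$$ Let $X$ be a random variable with $\mathcal L(X)=U$. Suppose that $$0<\sigma^2=\mathbf E X^2<\infty,\qquad \mathbf E X=0\qquad(\sigma>0),$$ and $$b\ge\frac{\varkappa_n}{\sigma^2},\qquad\text{where}\quad \varkappa_n=\mathbf E\, X^2\min\{|X|,\,\sigma\sqrt n\}.$$ Let $r,s$ be integers with $0\le r<s\le n$, and let $\mu$ be a random variable having the binomial distribution with parameters $n$ and $p$. Then, for any distribution $H\in\mathfrak F$, $$ \begin{aligned} Q(HF^n,b)\le{}& \mathbf E\,\frac{c\,b}{\sigma\sqrt{n-\mu}}\,Q\big(HV^\mu,\,\sigma\sqrt{n-\mu}\big)\,\mathbf I\{r\le\mu<s\} +\mathbf E\, Q\big(HU^{n-\mu}V^\mu,\,b\big)\,\mathbf I\{\mu\ge s\}\\ &+\min\Big\{1,\,\frac{c\,b}{\sigma\sqrt{n-r}}\,Q\big(H,\,\sigma\sqrt n\big)\Big\}\,\mathbf P\{\mu<r\}. \end{aligned} $$ Moreover, $$ Q(HF^n,b)\le \frac{c\,b}{\sigma\sqrt{n(1-p)}}\,Q\big(HV^r,\,\sigma\sqrt n\big)+\min\Big\{1,\,\frac{c\,b}{\sigma\sqrt{n-r}}\,Q\big(H,\,\sigma\sqrt n\big)\Big\}\,\mathbf P\{\mu<r\}. $$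
   Context: $\mathfrak F$ denotes the set of probability distributions on the Borel $\sigma$-field of $\mathbf R$; $\mathcal L(\xi)\in\mathfrak F$ is the distribution of a random variable $\xi$; $\mathbf I\{A\}$ is the indicator function of an event $A$. For $F\in\mathfrak F$ and $b\ge0$ the concentration function is $Q(F,b)=\sup_{x\in\mathbf R}F\{[x,x+b]\}$. Products and powers of measures are in the convolution sense: $FH=F*H$, $H^m=H^{m*}$ ($m$-fold convolution), and $H^0=E$, where $E$ is the distribution concentrated at the point $0$. In expressions such as $\mathbf E\,Q(HV^\mu,\cdot)$ the expectation is taken over the random variable $\mu$; a product with an indicator is understood to be $0$ when the indicator vanishes. An absolute constant is a positive number depending on none of the objects in the statement ($n,p,F,U,V,H,b,r,s$). *)

theory Defs
  imports "HOL-Probability.Probability"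
begin

text \<open>
  Probability distributions on the Borel sigma-field of the reals are measures satisfying the
  library locale \<^locale>\<open>real_distribution\<close>; products of them are convolutions
  (\<^const>\<open>convolution\<close>, written with a star).
\<close>

definition concentration :: "real measure \<Rightarrow> real \<Rightarrow> real" where
  "concentration F b = (SUP x. measure F {x..x + b})"

primrec conv_power :: "real measure \<Rightarrow> nat \<Rightarrow> real measure" where
  "conv_power H 0 = return borel 0"
| "conv_power H (Suc m) = (H \<star> conv_power H m)"

end

theory Submission
  imports Defs
begin

text \<open>
  Convolving with \<open>U\<close> a number \<open>m\<close> of times spreads mass over the scale \<open>a = \<sigma> sqrt m\<close>, and it
  does so without leaving lumps on the much smaller scale \<open>b\<close>. The quantitative form is the
  smoothing inequality \<open>Q(W U^m, b) \<le> C b / a * Q(W, a)\<close> for \<open>m \<le> n\<close> (\<open>concentration_smoothing\<close>),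
  and both claims follow from it by conditioning on how many of the \<open>n\<close> factors of \<open>F^n\<close> are drawn
  from \<open>V\<close>: that number is binomial, so \<open>Q(H F^n, b)\<close> is at most the average of
  \<open>Q(H U^(n-\<mu>) V^\<mu>, b)\<close> (\<open>concentration_mixture_power_le\<close>).

  For the smoothing inequality a bound on the integral of the modulus
  of the transform of \<open>W\<close> would not do, since the characteristic
  function of a general \<open>W\<close> is not controlled by its concentration function. Instead the mass that
  \<open>U^m\<close> gives to an interval \<open>[z, z+b]\<close> is bounded together with its decay in \<open>z\<close>, by a multiple of
  \<open>(b / a) / (1 + (z/a)^2)\<close> (\<open>local_estimate\<close>). Integrating this profile against \<open>W\<close> costs
  only a multiple of \<open>Q(W, a)\<close>, because an interval of length of order \<open>2^j a\<close> carries weight of order \<open>4^-j\<close>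
  and is covered by about \<open>2^j\<close> intervals of length \<open>a\<close> (\<open>integral_inverse_quadratic_le\<close>).

  The local estimate is Fourier-analytic. For a sum \<open>S\<close> with law \<open>U^m\<close>, the mean of
  \<open>(a^2 + S^2) I{S \<in> [x, x+b]}\<close> is dominated by the mean of \<open>a^2 + S^2\<close> against a Fejer kernel of
  width \<open>1/T\<close>, \<open>T = 1/(4b)\<close>. The kernel is a mixture of frequencies in \<open>[0, T]\<close>, so only
  \<open>E exp(itS)\<close> and \<open>E S^2 exp(itS)\<close> with \<open>t \<le> T\<close> matter; the first is \<open>\<phi>(t)^m\<close>, the second is an explicit
  polynomial in the moments of one summand times \<open>\<phi>(t)^(m-1)\<close> and \<open>\<phi>(t)^(m-2)\<close>
  (\<open>char_moment_conv_power\<close>). The hypothesis on \<open>b\<close> makes the error in the second-order Taylor expansion of \<open>\<phi>\<close>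
  at most half of the quadratic term for \<open>1 / (\<sigma> sqrt n) \<le> t \<le> T\<close>, whence \<open>|\<phi>(t)|^m\<close> has Gaussian
  decay in \<open>a t\<close>; for smaller \<open>t\<close> the Gaussian factor is itself bounded below (\<open>norm_char_power_le\<close>).

  The second claim in addition needs that the mean of \<open>(n - \<mu>)^(-1/2)\<close> (read as \<open>1\<close> at
  \<open>\<mu> = n\<close>) is at most of order \<open>(n (1 - p))^(-1/2)\<close> (\<open>expectation_inverse_sqrt_binomial_le\<close>).
\<close>

section \<open>Convolutions of probability distributions\<close>

lemma real_distribution_convolution:
  assumes "real_distribution M" "real_distribution N"
  shows "real_distribution (M \<star> N)"
proof -
  interpret M: real_distribution M by fact
  interpret N: real_distribution N by fact
  interpret pair_prob_space M N ..
  show ?thesis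
    unfolding convolution_def by (rule real_distribution_distr) simp
qed

lemma real_distribution_conv_power:
  assumes "real_distribution M"
  shows "real_distribution (conv_power M m)"
proof (induction m)
  case 0
  have "prob_space (return borel (0::real))" by (rule prob_space_return) simp
  then show ?case
    by (simp add: real_distribution_def real_distribution_axioms_def)
qed (simp add: real_distribution_convolution assms)

lemma convolution_comm:
  assumes "real_distribution M" "real_distribution N"
  shows "(M \<star> N) = (N \<star> M)"
proof -
  interpret M: real_distribution M by fact
  interpret N: real_distribution N by fact
  show ?thesis by (rule convolution_commutative) (auto simp: M.finite_measure_axioms N.finite_measure_axioms)
qed

lemma convolution_assoc:
  assumes "real_distribution L" "real_distribution M" "real_distribution N"
  shows "((L \<star> M) \<star> N) = (L \<star> (M \<star> N))"
proof -
  interpret L: real_distribution L by fact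
  interpret M: real_distribution M by fact
  interpret N: real_distribution N by fact
  show ?thesis
    by (rule convolution_associative[symmetric])
       (auto simp: L.finite_measure_axioms M.finite_measure_axioms N.finite_measure_axioms)
qed

lemma convolution_right_comm:
  assumes "real_distribution L" "real_distribution M" "real_distribution N"
  shows "((L \<star> M) \<star> N) = ((L \<star> N) \<star> M)"
  by (simp add: assms convolution_assoc convolution_comm[OF assms(2,3)])

lemma integral_convolution:
  fixes f :: "real \<Rightarrow> 'a::{banach, second_countable_topology}"
  assumes "real_distribution M" "real_distribution N" and f: "integrable (M \<star> N) f"
  shows "(LINT z|(M \<star> N). f z) = (LINT x|M. (LINT y|N. f (x + y)))"
proof -
  interpret M: real_distribution M by fact
  interpret N: real_distribution N by fact
  interpret pair_prob_space M N ..
  have [measurable]: "f \<in> borel_measurable borel"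
    using borel_measurable_integrable[OF f] by simp
  have [measurable]: "(\<lambda>(x,y). x + y) \<in> borel_measurable (M \<Otimes>\<^sub>M N)" by simp
  have int: "integrable (M \<Otimes>\<^sub>M N) (\<lambda>(x, y). f (x + y))"
    using f unfolding convolution_def by (subst (asm) integrable_distr_eq) (auto simp: case_prod_unfold)
  have "(LINT z|(M \<star> N). f z) = (LINT z|(M \<Otimes>\<^sub>M N). (\<lambda>(x, y). f (x + y)) z)"
    unfolding convolution_def by (subst integral_distr) (auto simp: case_prod_unfold)
  also have "\<dots> = (LINT x|M. (LINT y|N. f (x + y)))"
    using integral_fst'[OF int] by simp
  finally show ?thesis .
qed

lemma measure_convolution:
  assumes "real_distribution M" "real_distribution N" and A: "A \<in> sets borel"
  shows "measure (M \<star> N) A = (LINT x|M. measure N {y. x + y \<in> A})"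
proof -
  interpret M: real_distribution M by fact
  interpret N: real_distribution N by fact
  interpret MN: real_distribution "M \<star> N" by (rule real_distribution_convolution) fact+
  have "measure (M \<star> N) A = (LINT z|(M \<star> N). indicator A z)"
    using A by (simp add: MN.events_eq_borel)
  also have "\<dots> = (LINT x|M. (LINT y|N. indicator A (x + y)))"
    using A by (intro integral_convolution assms integrable_real_indicator)
      (auto simp: MN.emeasure_eq_measure)
  also have "\<dots> = (LINT x|M. measure N {y. x + y \<in> A})"
  proof (intro Bochner_Integration.integral_cong refl)
    fix x
    have "{y. x + y \<in> A} \<in> sets borel"
      using measurable_sets_borel[of "\<lambda>y. x + y" borel A] A by (simp add: vimage_def)
    moreover have "(\<lambda>y. indicator A (x + y)) = (indicator {y. x + y \<in> A} :: real \<Rightarrow> real)"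
      by (auto simp: indicator_def)
    ultimately show "(LINT y|N. indicator A (x + y)) = measure N {y. x + y \<in> A}"
      by simp
  qed
  finally show ?thesis .
qed

lemma measure_convolution_interval:
  assumes "real_distribution M" "real_distribution N"
  shows "measure (M \<star> N) {x..x+b} = (LINT y|M. measure N {x - y..x - y + b})"
proof -
  have "{z. y + z \<in> {x..x+b}} = {x - y..x - y + b}" for y by auto
  with measure_convolution[OF assms, of "{x..x+b}"] show ?thesis by simp
qed

lemma conv_power_add:
  assumes "real_distribution M"
  shows "conv_power M (i + j) = (conv_power M i \<star> conv_power M j)"
proof (induction i)
  case 0
  note R = real_distribution_conv_power[OF assms]
  interpret N: real_distribution "conv_power M j" by (rule R)
  have "conv_power M j = (return borel 0 \<star> conv_power M j)"
  proof (rule measure_eqI)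
    fix A assume A: "A \<in> sets (conv_power M j)"
    interpret M0: real_distribution "return borel (0::real)" using R[of 0] by simp
    interpret MN: real_distribution "return borel 0 \<star> conv_power M j"
      using R[of 0] by (intro real_distribution_convolution) (auto simp: N.real_distribution_axioms)
    have A': "A \<in> sets borel" using A by simp
    show "emeasure (conv_power M j) A = emeasure (return borel 0 \<star> conv_power M j) A"
      by (subst convolution_emeasure)
         (use A' in \<open>auto simp: M0.finite_measure_axioms N.finite_measure_axioms nn_integral_return\<close>)
  qed simp
  then show ?case by simp
qed (simp add: convolution_assoc assms real_distribution_conv_power)

section \<open>The concentration function\<close>

lemma measure_le_concentration:
  assumes "real_distribution M"
  shows "measure M {x..x+b} \<le> concentration M b"
proof -
  interpret real_distribution M by fact
  show ?thesis unfolding concentration_def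
    by (rule cSUP_upper) (auto intro!: bdd_aboveI2[where M=1])
qed

lemma concentration_le:
  assumes "\<And>x. measure M {x..x+b} \<le> B"
  shows "concentration M b \<le> B"
  unfolding concentration_def by (rule cSUP_least) (auto simp: assms)

lemma concentration_nonneg:
  assumes "real_distribution M"
  shows "0 \<le> concentration M b"
  using measure_le_concentration[OF assms, of 0 b] measure_nonneg[of M] order_trans by blast

lemma concentration_le_1:
  assumes "real_distribution M"
  shows "concentration M b \<le> 1"
proof -
  interpret real_distribution M by fact
  show ?thesis by (rule concentration_le) simp
qed

lemma concentration_mono:
  assumes "real_distribution M" "b \<le> b'"
  shows "concentration M b \<le> concentration M b'"
proof (rule concentration_le)
  interpret real_distribution M by fact
  fix x
  have "measure M {x..x+b} \<le> measure M {x..x+b'}"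
    using assms by (intro finite_measure_mono) auto
  also have "\<dots> \<le> concentration M b'" by (rule measure_le_concentration) fact
  finally show "measure M {x..x+b} \<le> concentration M b'" .
qed

text \<open>
  An interval of length \<open>k a\<close> is a union of \<open>k\<close> intervals of length \<open>a\<close>; the maximum with \<open>1\<close> covers
  the degenerate interval \<open>{x}\<close> at \<open>k = 0\<close>.
\<close>

lemma concentration_multiple:
  assumes "real_distribution M" "0 \<le> a"
  shows "measure M {x..x + real k * a} \<le> max 1 (real k) * concentration M a"
proof (induction k)
  case 0
  have "measure M {x..x + 0} \<le> concentration M 0"
    by (rule measure_le_concentration) fact
  also have "\<dots> \<le> concentration M a"
    by (rule concentration_mono) fact+
  finally show ?case by simp
next
  case (Suc k)
  interpret real_distribution M by fact
  show ?case
  proof (cases "k = 0")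
    case True
    then show ?thesis using measure_le_concentration[OF assms(1), of x a] by simp
  next
    case False
    have "measure M {x..x + real (Suc k) * a} \<le> measure M ({x..x + real k * a} \<union> {x + real k * a..x + real k * a + a})"
      by (intro finite_measure_mono) (auto simp: algebra_simps)
    also have "\<dots> \<le> measure M {x..x + real k * a} + measure M {x + real k * a..x + real k * a + a}"
      by (rule measure_Un_le) auto
    also have "\<dots> \<le> max 1 (real k) * concentration M a + concentration M a"
      by (intro add_mono Suc measure_le_concentration assms)
    also have "\<dots> = max 1 (real (Suc k)) * concentration M a"
      using False by (simp add: algebra_simps)
    finally show ?thesis .
  qed
qed

lemma concentration_scale:
  assumes "real_distribution M" "0 < a" "0 \<le> b"
  shows "concentration M b \<le> (1 + b / a) * concentration M a"
proof (rule concentration_le)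
  interpret real_distribution M by fact
  fix x
  define k where "k = nat \<lceil>b / a\<rceil>"
  have k: "b / a \<le> real k" "real k \<le> 1 + b / a"
    unfolding k_def using assms by (auto simp: of_nat_nat) linarith+
  have "b \<le> real k * a" using k(1) assms(2) by (simp add: field_simps)
  then have "measure M {x..x+b} \<le> measure M {x..x + real k * a}"
    by (intro finite_measure_mono) auto
  also have "\<dots> \<le> max 1 (real k) * concentration M a"
    by (rule concentration_multiple) (use assms in auto)
  also have "\<dots> \<le> (1 + b / a) * concentration M a"
    using k(2) assms by (intro mult_right_mono concentration_nonneg) auto
  finally show "measure M {x..x+b} \<le> (1 + b / a) * concentration M a" .
qed

text \<open>
  An independent summand can be conditioned on: it merely shifts the interval.
\<close>

lemma concentration_convolution:
  assumes M: "real_distribution M" and N: "real_distribution N"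
  shows "concentration (M \<star> N) b \<le> concentration M b"
proof (rule concentration_le)
  fix x
  interpret M: real_distribution M by fact
  interpret N: real_distribution N by fact
  have "measure (M \<star> N) {x..x+b} = measure (N \<star> M) {x..x+b}"
    by (simp add: convolution_comm[OF M N])
  also have "\<dots> = (LINT y|N. measure M {x - y..x - y + b})"
    by (rule measure_convolution_interval) fact+
  also have "\<dots> \<le> (LINT y|N. concentration M b)"
    by (rule integral_mono')
       (auto intro!: measure_le_concentration M concentration_nonneg)
  also have "\<dots> = concentration M b"
    using N.prob_space by simp
  finally show "measure (M \<star> N) {x..x+b} \<le> concentration M b" .
qed

section \<open>Moments weighted by a character\<close>

text \<open>
  Up to the factor \<open>\<i>^k\<close> this is the \<open>k\<close>-th derivative of the characteristic function. Written as an
  integral, it has a Leibniz rule under convolution that is an instance of Fubini's theorem.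
\<close>

definition char_moment :: "nat \<Rightarrow> real measure \<Rightarrow> real \<Rightarrow> complex" where
  "char_moment k M t = (CLINT x|M. of_real (x ^ k) * iexp (t * x))"

lemma char_moment_0: "char_moment 0 M t = char M t"
  by (simp add: char_moment_def char_def)

lemma (in real_distribution) integrable_first_moment:
  "integrable M (\<lambda>x. x\<^sup>2) \<Longrightarrow> integrable M (\<lambda>x. x)"
  by (rule square_integrable_imp_integrable) auto

lemma (in real_distribution) integrable_char_moment:
  assumes "integrable M (\<lambda>x. x\<^sup>2)" "k \<le> 2"
  shows "complex_integrable M (\<lambda>x. of_real (x ^ k) * iexp (t * x))"
proof -
  have "integrable M (\<lambda>x. x ^ k)"
  proof -
    from \<open>k \<le> 2\<close> consider "k = 0" | "k = 1" | "k = 2" by linarith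
    then show ?thesis
      by cases (use assms(1) integrable_first_moment[OF assms(1)] in auto)
  qed
  then show ?thesis
    by (rule Bochner_Integration.integrable_bound)
       (auto simp: norm_mult norm_power power_abs)
qed

lemma integrable_square_convolution:
  assumes M: "real_distribution M" and N: "real_distribution N"
    and iM: "integrable M (\<lambda>x. x\<^sup>2)" and iN: "integrable N (\<lambda>x. x\<^sup>2)"
  shows "integrable (M \<star> N) (\<lambda>x. x\<^sup>2)"
proof -
  interpret M: real_distribution M by fact
  interpret N: real_distribution N by fact
  have "(\<integral>\<^sup>+z. ennreal (z\<^sup>2) \<partial>(M \<star> N)) = (\<integral>\<^sup>+x. \<integral>\<^sup>+y. ennreal ((x + y)\<^sup>2) \<partial>N \<partial>M)"
    by (rule nn_integral_convolution) (auto simp: M.finite_measure_axioms N.finite_measure_axioms)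
  also have "\<dots> \<le> (\<integral>\<^sup>+x. \<integral>\<^sup>+y. ennreal (2 * x\<^sup>2) + ennreal (2 * y\<^sup>2) \<partial>N \<partial>M)"
  proof (intro nn_integral_mono)
    fix x y :: real
    have "(x + y)\<^sup>2 \<le> 2 * x\<^sup>2 + 2 * y\<^sup>2"
      using zero_le_power2[of "x - y"] by (simp add: power2_sum power2_diff)
    then show "ennreal ((x + y)\<^sup>2) \<le> ennreal (2 * x\<^sup>2) + ennreal (2 * y\<^sup>2)"
      by (simp flip: ennreal_plus add: ennreal_leI)
  qed
  also have "\<dots> = (\<integral>\<^sup>+x. ennreal (2 * x\<^sup>2) \<partial>M) + (\<integral>\<^sup>+y. ennreal (2 * y\<^sup>2) \<partial>N)"
    by (simp add: nn_integral_add M.emeasure_space_1 N.emeasure_space_1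
        del: M.space_eq_univ N.space_eq_univ)
  also have "\<dots> < \<infinity>"
    using iM iN by (subst (1 2) nn_integral_eq_integral) auto
  finally show ?thesis
    by (intro integrableI_bounded) auto
qed

lemma integrable_square_conv_power:
  assumes "real_distribution M" "integrable M (\<lambda>x. x\<^sup>2)"
  shows "integrable (conv_power M m) (\<lambda>x. x\<^sup>2)"
proof (induction m)
  case 0
  interpret R: real_distribution "return borel (0::real)"
    using real_distribution_conv_power[OF assms(1), of 0] by simp
  have "integrable (return borel (0::real)) (\<lambda>x. x\<^sup>2) \<longleftrightarrow> integrable (return borel (0::real)) (\<lambda>x. 0::real)"
    by (rule integrable_cong_AE) (auto simp: AE_return)
  then show ?case by simp
qed (simp add: integrable_square_convolution assms real_distribution_conv_power)

text \<open>
  Expand \<open>(x + y)^k\<close> binomially and use \<open>exp(it(x + y)) = exp(itx) exp(ity)\<close>: the integrand becomes a sum of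
  products of a function of \<open>x\<close> and a function of \<open>y\<close>.
\<close>

lemma char_moment_convolution:
  assumes M: "real_distribution M" and N: "real_distribution N"
    and iM: "integrable M (\<lambda>x. x\<^sup>2)" and iN: "integrable N (\<lambda>x. x\<^sup>2)"
  shows "char_moment 0 (M \<star> N) t = char_moment 0 M t * char_moment 0 N t"
    and "char_moment 1 (M \<star> N) t =
      char_moment 1 M t * char_moment 0 N t + char_moment 0 M t * char_moment 1 N t"
    and "char_moment 2 (M \<star> N) t =
      char_moment 2 M t * char_moment 0 N t + 2 * char_moment 1 M t * char_moment 1 N t
        + char_moment 0 M t * char_moment 2 N t"
proof -
  interpret M: real_distribution M by fact
  interpret N: real_distribution N by fact
  interpret MN: real_distribution "M \<star> N" by (rule real_distribution_convolution) fact+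
  define e where "e x = iexp (t * x)" for x
  define f where "f k x = of_real (x ^ k) * e x" for k and x :: real
  have iexp_add: "e (x + y) = e x * e y" for x y
    by (simp add: e_def distrib_left exp_add)
  have mom: "char_moment k L t = (CLINT x|L. f k x)" for k L
    by (simp add: char_moment_def f_def e_def)
  have fM: "complex_integrable M (f k)" if "k \<le> 2" for k
    unfolding f_def e_def using M.integrable_char_moment[OF iM that] .
  have fN: "complex_integrable N (f k)" if "k \<le> 2" for k
    unfolding f_def e_def using N.integrable_char_moment[OF iN that] .
  have fMN: "complex_integrable (M \<star> N) (f k)" if "k \<le> 2" for k
    unfolding f_def e_def
    using MN.integrable_char_moment[OF integrable_square_convolution[OF assms] that] .
  note [simp] = fM fN
  have conv: "char_moment k (M \<star> N) t = (CLINT x|M. (CLINT y|N. f k (x + y)))" if "k \<le> 2" for k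
    unfolding mom by (rule integral_convolution[OF M N fMN[OF that]])
  have 0: "f 0 (x + y) = f 0 x * f 0 y" for x y
    by (simp add: f_def iexp_add)
  have 1: "f 1 (x + y) = f 1 x * f 0 y + f 0 x * f 1 y" for x y
    by (simp add: f_def iexp_add algebra_simps)
  have 2: "f 2 (x + y) = f 2 x * f 0 y + 2 * f 1 x * f 1 y + f 0 x * f 2 y" for x y
    by (simp add: f_def iexp_add algebra_simps power2_eq_square)
  show "char_moment 0 (M \<star> N) t = char_moment 0 M t * char_moment 0 N t"
    by (subst conv) (simp_all add: 0 mom)
  show "char_moment 1 (M \<star> N) t =
      char_moment 1 M t * char_moment 0 N t + char_moment 0 M t * char_moment 1 N t"
    by (subst conv) (simp_all add: 1 mom del: One_nat_def)
  show "char_moment 2 (M \<star> N) t =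
      char_moment 2 M t * char_moment 0 N t + 2 * char_moment 1 M t * char_moment 1 N t
        + char_moment 0 M t * char_moment 2 N t"
    by (subst conv) (simp_all add: 2 mom del: One_nat_def)
qed

text \<open>
  The truncated exponents \<open>m - 1\<close> and \<open>m - 2\<close> are harmless, since for \<open>m\<close> too small their coefficients
  vanish.
\<close>

lemma char_moment_conv_power:
  assumes M: "real_distribution M" and iM: "integrable M (\<lambda>x. x\<^sup>2)"
  shows "char_moment 0 (conv_power M m) t = char M t ^ m"
    and "char_moment 1 (conv_power M m) t = of_nat m * char_moment 1 M t * char M t ^ (m - 1)"
    and "char_moment 2 (conv_power M m) t = of_nat m * char_moment 2 M t * char M t ^ (m - 1)
           + of_nat (m * (m - 1)) * (char_moment 1 M t)\<^sup>2 * char M t ^ (m - 2)"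
proof (induction m)
  case 0
  have "complex_integrable (return borel (0::real)) (\<lambda>x. of_real (x ^ k) * iexp (t * x))
    \<Longrightarrow> char_moment k (return borel 0) t = 0 ^ k" for k
    unfolding char_moment_def by (subst integral_return) auto
  then have ret: "char_moment k (return borel 0) t = 0 ^ k" if "k \<le> 2" for k
    using real_distribution.integrable_char_moment[OF real_distribution_conv_power[OF M]
        integrable_square_conv_power[OF M iM] that, of 0 t] by simp
  {
    case 1 show ?case by (simp add: ret)
  next
    case 2 show ?case by (simp add: ret del: One_nat_def)
  next
    case 3 show ?case by (simp add: ret)
  }
next
  case (Suc m)
  note conv = char_moment_convolution[OF M real_distribution_conv_power[OF M, of m] iM
      integrable_square_conv_power[OF M iM, of m], of t]
  note IH = Suc.IH
  {
    case 1 show ?case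
      unfolding conv_power.simps conv IH by (simp add: char_moment_0)
  next
    case 2 show ?case
      unfolding conv_power.simps conv IH unfolding char_moment_0
      by (cases m) (simp_all add: algebra_simps)
  next
    case 3
    consider "m = 0" | "m = 1" | j where "m = Suc (Suc j)"
      by (metis One_nat_def not0_implies_Suc)
    then show ?case
      unfolding conv_power.simps conv IH unfolding char_moment_0
      by cases (simp_all add: algebra_simps power2_eq_square)
  }
qed

text \<open>
  Since the mean vanishes, \<open>exp(itx)\<close> may be replaced by \<open>exp(itx) - 1\<close>, which is at most \<open>|t x|\<close>.
\<close>

lemma (in real_distribution) norm_char_moment_1_le:
  assumes "integrable M (\<lambda>x. x\<^sup>2)" "(LINT x|M. x) = 0"
  shows "norm (char_moment 1 M t) \<le> \<bar>t\<bar> * (LINT x|M. x\<^sup>2)"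
proof -
  have i1: "complex_integrable M (\<lambda>x. of_real x * iexp (t * x))"
    using integrable_char_moment[OF assms(1), of 1 t] by simp
  have i2: "complex_integrable M (\<lambda>x. of_real x)"
    using integrable_first_moment[OF assms(1)] by (rule integrable_of_real)
  have "char_moment 1 M t = (CLINT x|M. of_real x * iexp (t * x)) - (CLINT x|M. of_real x)"
    using assms(2) by (simp add: char_moment_def)
  also have "\<dots> = (CLINT x|M. of_real x * iexp (t * x) - of_real x)"
    using i1 i2 by simp
  also have "norm \<dots> \<le> (LINT x|M. norm (of_real x * iexp (t * x) - of_real x))"
    by (rule integral_norm_bound)
  also have "\<dots> \<le> (LINT x|M. \<bar>t\<bar> * x\<^sup>2)"
  proof (rule integral_mono)
    fix x
    have "norm (of_real x * iexp (t * x) - of_real x) = \<bar>x\<bar> * norm (iexp (t * x) - 1)"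
      by (metis (no_types, opaque_lifting) mult.right_neutral norm_mult norm_of_real right_diff_distrib)
    also have "\<dots> \<le> \<bar>x\<bar> * \<bar>t * x\<bar>"
      using iexp_approx1[of "t * x" 0] by (intro mult_left_mono) auto
    finally show "norm (of_real x * iexp (t * x) - of_real x) \<le> \<bar>t\<bar> * x\<^sup>2"
      by (simp add: abs_mult power2_eq_square mult.left_commute)
  qed (use i1 i2 assms(1) in auto)
  finally show ?thesis by simp
qed

lemma (in real_distribution) norm_char_moment_2_le:
  "norm (char_moment 2 M t) \<le> (LINT x|M. x\<^sup>2)"
  unfolding char_moment_def using integral_norm_bound[of M "\<lambda>x. of_real (x\<^sup>2) * iexp (t * x)"]
  by (simp add: norm_mult norm_power)

section \<open>The Fejer kernel and elementary estimates\<close>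

text \<open>
  The Fejer kernel, a mixture of the cosines with frequencies in \<open>[0,1]\<close>. The closed form shows
  that it is nonnegative; since it is also bounded below near \<open>0\<close> (\<open>fejer_kernel_ge\<close>), a multiple of it
  dominates the indicator of an interval while its Fourier transform has compact support.
\<close>

lemma fejer_kernel_eq:
  fixes z :: real
  assumes "z \<noteq> 0"
  shows "(LBINT u. (1 - u) * cos (u * z) * indicator {0..1} u) = (1 - cos z) / z\<^sup>2"
proof -
  have "(LBINT u. (1 - u) * cos (u * z) * indicator {0..1} u)
      = ((1 - 1) * sin (1 * z) / z - cos (1 * z) / z\<^sup>2) - ((1 - 0) * sin (0 * z) / z - cos (0 * z) / z\<^sup>2)"
    by (rule integral_FTC_Icc_real)
       (use assms in \<open>auto intro!: derivative_eq_intros continuous_intros simp: field_simps power2_eq_square\<close>)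
  then show ?thesis by (simp add: diff_divide_distrib)
qed

lemma integrable_Icc:
  fixes f :: "real \<Rightarrow> 'a::{banach, second_countable_topology}"
  assumes "continuous_on {a..b} f"
  shows "integrable lborel (\<lambda>u. indicator {a..b} u *\<^sub>R f u)"
  using borel_integrable_compact[OF _ assms] by (simp add: set_integrable_def)

lemma fejer_kernel_nonneg:
  fixes z :: real
  shows "0 \<le> (LBINT u. (1 - u) * cos (u * z) * indicator {0..1} u)"
proof (cases "z = 0")
  case True
  then show ?thesis by (intro Bochner_Integration.integral_nonneg) (auto simp: indicator_def)
next
  case False
  then show ?thesis by (simp add: fejer_kernel_eq)
qed

lemma cos_1_ge_half: "cos (1::real) \<ge> 1 / 2"
proof -
  have "cos (pi / 3) \<le> cos (1::real)"
    using pi_gt3 by (intro cos_monotone_0_pi_le) auto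
  then show ?thesis by (simp add: cos_60)
qed

lemma fejer_kernel_ge:
  fixes z :: real
  assumes "\<bar>z\<bar> \<le> 1"
  shows "1 / 4 \<le> (LBINT u. (1 - u) * cos (u * z) * indicator {0..1} u)"
proof -
  have int: "integrable lborel (\<lambda>u. g u * indicator {0..1} u)" if "continuous_on {0..1} g" for g :: "real \<Rightarrow> real"
    using integrable_Icc[OF that] by (simp add: mult.commute)
  have "1 / 4 = (LBINT u. (1 - u) / 2 * indicator {0..1::real} u)"
  proof -
    have "(LBINT u. (1 - u) / 2 * indicator {0..1::real} u) = (1 / 2 - 1\<^sup>2 / 4) - (0 / 2 - 0\<^sup>2 / 4)"
      by (rule integral_FTC_Icc_real)
         (auto intro!: derivative_eq_intros continuous_intros simp: field_simps)
    then show ?thesis by simp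
  qed
  also have "\<dots> \<le> (LBINT u. (1 - u) * cos (u * z) * indicator {0..1} u)"
  proof (rule integral_mono)
    fix u :: real
    show "(1 - u) / 2 * indicator {0..1::real} u \<le> (1 - u) * cos (u * z) * indicator {0..1} u"
    proof (cases "u \<in> {0..1}")
      case True
      have "\<bar>u * z\<bar> \<le> 1" using True assms by (auto simp: abs_mult intro: mult_le_one)
      then have "cos 1 \<le> cos \<bar>u * z\<bar>"
        using pi_gt3 by (intro cos_monotone_0_pi_le) auto
      then have "1 / 2 \<le> cos (u * z)" using cos_1_ge_half by simp
      then have "(1 - u) * (1 / 2) \<le> (1 - u) * cos (u * z)"
        using True by (intro mult_left_mono) auto
      then show ?thesis using True by simp
    qed simp
  qed (auto intro!: int continuous_intros)
  finally show ?thesis .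
qed

text \<open>
  Trades Gaussian decay for quadratic decay, so that the remaining integral over the frequencies is an arctangent.
\<close>

lemma exp_decay_le:
  fixes y :: real
  assumes "0 \<le> y"
  shows "exp (- y / 4) * (2 + y) \<le> 64 / (1 + y)"
proof -
  have "1 + y / 4 + (y / 4)\<^sup>2 / 2 \<le> exp (y / 4)"
    using assms by (intro exp_lower_Taylor_quadratic) auto
  then have "64 * (1 + y / 4 + (y / 4)\<^sup>2 / 2) \<le> 64 * exp (y / 4)"
    by (intro mult_left_mono) auto
  moreover have "(2 + y) * (1 + y) \<le> 64 * (1 + y / 4 + (y / 4)\<^sup>2 / 2)"
    using assms by (simp add: power2_eq_square algebra_simps)
  ultimately have "(2 + y) * (1 + y) \<le> 64 * exp (y / 4)" by linarith
  then show ?thesis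
    using assms by (simp add: exp_minus field_simps)
qed

lemma integral_cauchy_density_le:
  fixes c :: real
  assumes "0 < c"
  shows "(LBINT u. 1 / (1 + (c * u)\<^sup>2) * indicator {0..1} u) \<le> 2 / c"
proof -
  have "(LBINT u. 1 / (1 + (c * u)\<^sup>2) * indicator {0..1} u) = arctan (c * 1) / c - arctan (c * 0) / c"
  proof (rule integral_FTC_Icc_real)
    fix u :: real
    have "1 + (c * u)\<^sup>2 \<noteq> 0"
      by (metis add_nonneg_eq_0_iff zero_le_one zero_le_power2 zero_neq_one)
    have "((\<lambda>u. arctan (c * u) / c) has_real_derivative (c * (1 / (1 + (c * u)\<^sup>2))) / c) (at u)"
      by (auto intro!: derivative_eq_intros simp: divide_inverse mult.commute)
    then show "((\<lambda>u. arctan (c * u) / c) has_real_derivative 1 / (1 + (c * u)\<^sup>2)) (at u)"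
      using assms by simp
    from \<open>1 + (c * u)\<^sup>2 \<noteq> 0\<close> show "isCont (\<lambda>u. 1 / (1 + (c * u)\<^sup>2)) u"
      by (intro continuous_intros) auto
  qed simp
  also have "\<dots> \<le> 2 / c"
    using arctan_ubound[of c] pi_less_4 assms by (simp add: divide_right_mono)
  finally show ?thesis .
qed

section \<open>Characteristic functions of centred summands\<close>

text \<open>
  By this bound the hypothesis on \<open>b\<close> forces \<open>b\<close> to be at least of order \<open>\<sigma>\<close>. At
  least three quarters of the second moment come from \<open>|x| \<ge> \<sigma>/2\<close>, where the minimum is at
  least \<open>\<sigma>/2\<close>; this is expressed by the pointwise bound \<open>\<sigma>/2 (x^2 - \<sigma>^2/4) \<le> x^2 min |x| L\<close>.
\<close>

lemma truncated_moment_ge: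
  assumes U: "real_distribution U" and i2: "integrable U (\<lambda>x. x\<^sup>2)"
    and \<sigma>: "0 < \<sigma>" "\<sigma>\<^sup>2 = (LINT x|U. x\<^sup>2)" and L: "\<sigma> \<le> L"
  shows "3 / 8 * \<sigma> ^ 3 \<le> (LINT x|U. x\<^sup>2 * min \<bar>x\<bar> L)"
proof -
  interpret real_distribution U by fact
  have iL: "integrable U (\<lambda>x. x\<^sup>2 * min \<bar>x\<bar> L)"
  proof (rule Bochner_Integration.integrable_bound)
    show "integrable U (\<lambda>x. L * x\<^sup>2)" using i2 by simp
    show "AE x in U. norm (x\<^sup>2 * min \<bar>x\<bar> L) \<le> norm (L * x\<^sup>2)"
      using \<sigma>(1) L by (auto simp: abs_mult mult.commute intro!: mult_right_mono)
  qed auto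
  have "3 / 8 * \<sigma> ^ 3 = (LINT x|U. \<sigma> / 2 * (x\<^sup>2 - (\<sigma> / 2)\<^sup>2))"
    using i2 \<sigma>(2) prob_space by (simp add: power2_eq_square power3_eq_cube del: space_eq_univ)
  also have "\<dots> \<le> (LINT x|U. x\<^sup>2 * min \<bar>x\<bar> L)"
  proof (rule integral_mono)
    fix x :: real
    show "\<sigma> / 2 * (x\<^sup>2 - (\<sigma> / 2)\<^sup>2) \<le> x\<^sup>2 * min \<bar>x\<bar> L"
    proof (cases "\<sigma> / 2 \<le> \<bar>x\<bar>")
      case True
      then have "\<sigma> / 2 * x\<^sup>2 \<le> min \<bar>x\<bar> L * x\<^sup>2"
        using \<sigma>(1) L by (intro mult_right_mono) auto
      moreover have "0 \<le> \<sigma> / 2 * (\<sigma> / 2)\<^sup>2" using \<sigma>(1) by simp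
      ultimately show ?thesis by (simp add: algebra_simps)
    next
      case False
      then have "\<bar>x\<bar>\<^sup>2 \<le> (\<sigma> / 2)\<^sup>2" by (intro power_mono) auto
      then have "\<sigma> / 2 * (x\<^sup>2 - (\<sigma> / 2)\<^sup>2) \<le> 0"
        using \<sigma>(1) by (intro mult_nonneg_nonpos) auto
      also have "0 \<le> x\<^sup>2 * min \<bar>x\<bar> L" using \<sigma>(1) L by simp
      finally show ?thesis .
    qed
  qed (use i2 iL in auto)
  finally show ?thesis .
qed

text \<open>
  The name \<open>b\<close> stands for the interval length throughout; the integral in \<open>width_ge\<close> is a third absolute moment
  truncated at \<open>\<sigma> sqrt n\<close>, which is finite although only the second moment is assumed to be.
\<close>

locale centred_summand =
  U: real_distribution U for U :: "real measure" +
  fixes \<sigma> b :: real and n :: nat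
  assumes square_integrable: "integrable U (\<lambda>x. x\<^sup>2)"
    and \<sigma>_pos: "0 < \<sigma>"
    and variance_eq: "\<sigma>\<^sup>2 = (LINT x|U. x\<^sup>2)"
    and centred: "(LINT x|U. x) = 0"
    and n_pos: "1 \<le> n"
    and width_ge: "b \<ge> (LINT x|U. x\<^sup>2 * min \<bar>x\<bar> (\<sigma> * sqrt (real n))) / \<sigma>\<^sup>2"
begin

lemma \<sigma>_le: "\<sigma> \<le> \<sigma> * sqrt (real n)"
  using n_pos \<sigma>_pos by (simp add: mult_le_cancel_left1)

lemma width_ge_\<sigma>: "3 / 8 * \<sigma> \<le> b"
proof -
  have "3 / 8 * \<sigma> = 3 / 8 * \<sigma> ^ 3 / \<sigma>\<^sup>2"
    using \<sigma>_pos by (simp add: power2_eq_square power3_eq_cube)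
  also have "\<dots> \<le> (LINT x|U. x\<^sup>2 * min \<bar>x\<bar> (\<sigma> * sqrt (real n))) / \<sigma>\<^sup>2"
    by (intro divide_right_mono truncated_moment_ge U.real_distribution_axioms square_integrable
        \<sigma>_pos variance_eq \<sigma>_le) simp
  also note width_ge
  finally show ?thesis .
qed

lemma width_pos: "0 < b"
  using width_ge_\<sigma> \<sigma>_pos by linarith

text \<open>
  On the admissible frequencies the quadratic Taylor term is small, so \<open>1 - \<sigma>^2 t^2 / 2\<close> is its own modulus.
\<close>

lemma square_le_1:
  assumes "0 \<le> t" "t \<le> 1 / (4 * b)"
  shows "(\<sigma> * t)\<^sup>2 \<le> 1"
proof -
  have "3 / 8 * (\<sigma> * t) \<le> b * t"
    using mult_right_mono[OF width_ge_\<sigma> assms(1)] by simp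
  moreover have "b * t \<le> 1 / 4" using assms(2) width_pos by (simp add: field_simps)
  ultimately have "\<sigma> * t \<le> 1" by linarith
  then show ?thesis using \<sigma>_pos assms(1) by (simp add: power_le_one)
qed

text \<open>
  The Taylor remainder of \<open>exp(itx)\<close> is at most \<open>min(t^2 x^2, |t x|^3 / 6)\<close>. As soon as \<open>t \<sigma> sqrt n \<ge> 1\<close>,
  this is at most \<open>t^3 x^2 min(|x|, \<sigma> sqrt n)\<close>, whose mean is at most \<open>t^3 b \<sigma>^2 \<le> \<sigma>^2 t^2 / 4\<close>: half
  of the quadratic term.
\<close>

lemma norm_char_le_exp:
  assumes "1 / (\<sigma> * sqrt (real n)) \<le> t" "t \<le> 1 / (4 * b)"
  shows "norm (char U t) \<le> exp (- (\<sigma>\<^sup>2 * t\<^sup>2 / 4))"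
proof -
  define L where "L = \<sigma> * sqrt (real n)"
  have L: "0 < L" unfolding L_def using \<sigma>_pos n_pos by simp
  have t: "0 < t" using assms(1) L less_le_trans[of 0 "1 / L" t] by (simp add: L_def)
  have tL: "1 \<le> t * L" using assms(1) L by (simp add: L_def[symmetric] field_simps)
  have tb: "t * b \<le> 1 / 4" using assms(2) width_pos by (simp add: field_simps)
  have "U.variance (\<lambda>x. x) = \<sigma>\<^sup>2" using centred variance_eq by simp
  then have "norm (char U t - (1 - t\<^sup>2 * \<sigma>\<^sup>2 / 2)) \<le>
      t\<^sup>2 / 6 * (LINT x|U. min (6 * x\<^sup>2) (\<bar>t\<bar> * \<bar>x\<bar> ^ 3))"
    using U.char_approx3[OF U.integrable_first_moment[OF square_integrable] centred square_integrable]
    by (simp add: cmod_def)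
  also have "\<dots> \<le> t\<^sup>2 / 6 * (LINT x|U. 6 * t * (x\<^sup>2 * min \<bar>x\<bar> L))"
  proof (intro mult_left_mono integral_mono')
    show "integrable U (\<lambda>x. 6 * t * (x\<^sup>2 * min \<bar>x\<bar> L))"
    proof (rule Bochner_Integration.integrable_bound)
      show "integrable U (\<lambda>x. 6 * t * L * x\<^sup>2)" using square_integrable by simp
      show "AE x in U. norm (6 * t * (x\<^sup>2 * min \<bar>x\<bar> L)) \<le> norm (6 * t * L * x\<^sup>2)"
        using L t by (auto simp: abs_mult mult.commute intro!: mult_right_mono)
    qed auto
    fix x :: real
    have "x\<^sup>2 * 1 \<le> x\<^sup>2 * (t * L)" by (intro mult_left_mono tL) simp
    then have 1: "6 * x\<^sup>2 \<le> 6 * t * (x\<^sup>2 * L)" by (simp add: mult_ac)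
    have "t * \<bar>x\<bar> ^ 3 = t * (x\<^sup>2 * \<bar>x\<bar>)" by (simp add: power2_eq_square power3_eq_cube)
    moreover have "0 \<le> t * (x\<^sup>2 * \<bar>x\<bar>)" using t by simp
    ultimately have 2: "t * \<bar>x\<bar> ^ 3 \<le> 6 * t * (x\<^sup>2 * \<bar>x\<bar>)" by linarith
    show "min (6 * x\<^sup>2) (\<bar>t\<bar> * \<bar>x\<bar> ^ 3) \<le> 6 * t * (x\<^sup>2 * min \<bar>x\<bar> L)"
    proof (cases "\<bar>x\<bar> \<le> L")
      case True
      then show ?thesis using 2 t by (simp add: min.absorb1 min.coboundedI2)
    next
      case False
      then show ?thesis using 1 t by (simp add: min.absorb2 min.coboundedI1)
    qed
    show "0 \<le> 6 * t * (x\<^sup>2 * min \<bar>x\<bar> L)" using t L by simp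
  qed simp
  also have "\<dots> = t ^ 3 * (LINT x|U. x\<^sup>2 * min \<bar>x\<bar> L)"
    by (simp add: power2_eq_square power3_eq_cube)
  also have "\<dots> \<le> t ^ 3 * (b * \<sigma>\<^sup>2)"
    using width_ge \<sigma>_pos t by (intro mult_left_mono) (auto simp: L_def field_simps)
  also have "\<dots> = (t * b) * (\<sigma>\<^sup>2 * t\<^sup>2)" by (simp add: power2_eq_square power3_eq_cube)
  also have "\<dots> \<le> 1 / 4 * (\<sigma>\<^sup>2 * t\<^sup>2)" by (intro mult_right_mono tb) simp
  finally have approx: "norm (char U t - (1 - t\<^sup>2 * \<sigma>\<^sup>2 / 2)) \<le> \<sigma>\<^sup>2 * t\<^sup>2 / 4" by simp
  have "(\<sigma> * t)\<^sup>2 \<le> 1" by (intro square_le_1) (use t assms(2) in auto)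
  then have "norm (1 - t\<^sup>2 * \<sigma>\<^sup>2 / 2 :: complex) = 1 - t\<^sup>2 * \<sigma>\<^sup>2 / 2"
  proof -
    have "(1 - t\<^sup>2 * \<sigma>\<^sup>2 / 2 :: complex) = of_real (1 - t\<^sup>2 * \<sigma>\<^sup>2 / 2)" by simp
    then show ?thesis
      using \<open>(\<sigma> * t)\<^sup>2 \<le> 1\<close> by (simp only: norm_of_real) (simp add: power_mult_distrib mult.commute)
  qed
  then have "norm (char U t) \<le> 1 - \<sigma>\<^sup>2 * t\<^sup>2 / 4"
    using norm_triangle_sub[of "char U t" "1 - t\<^sup>2 * \<sigma>\<^sup>2 / 2"] approx by (simp add: mult.commute)
  also have "\<dots> \<le> exp (- (\<sigma>\<^sup>2 * t\<^sup>2 / 4))"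
    using exp_ge_add_one_self[of "- (\<sigma>\<^sup>2 * t\<^sup>2 / 4)"] by simp
  finally show ?thesis .
qed

text \<open>
  Two missing factors of the characteristic function cost only a constant, because \<open>\<sigma> t \<le> 1\<close>. Below the threshold
  \<open>1 / (\<sigma> sqrt n)\<close> the Taylor bound is not available, but there \<open>m \<le> n\<close> makes the right-hand side at least \<open>1\<close>.
\<close>

lemma norm_char_power_le:
  assumes t: "0 \<le> t" "t \<le> 1 / (4 * b)" and m: "m \<le> n" "m \<le> k + 2"
  shows "norm (char U t) ^ k \<le> 3 * exp (- (\<sigma>\<^sup>2 * real m * t\<^sup>2 / 4))"
proof (cases "1 / (\<sigma> * sqrt (real n)) \<le> t")
  case True
  have "(\<sigma> * t)\<^sup>2 \<le> 1" by (intro square_le_1) (use t assms(2) in auto)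
  define y where "y = \<sigma>\<^sup>2 * t\<^sup>2"
  have y: "0 \<le> y" "y \<le> 1" using \<open>(\<sigma> * t)\<^sup>2 \<le> 1\<close> by (auto simp: y_def power_mult_distrib)
  have "norm (char U t) ^ k \<le> exp (- (y / 4)) ^ k"
    unfolding y_def by (intro power_mono norm_char_le_exp True t) simp
  also have "\<dots> = exp (- (real k * y / 4))"
    by (simp flip: exp_of_nat_mult)
  also have "\<dots> \<le> exp (1 - real m * y / 4)"
  proof -
    have "real m * y \<le> (real k + 2) * y"
      using m(2) y by (intro mult_right_mono) auto
    then show ?thesis using y by (simp add: algebra_simps)
  qed
  also have "\<dots> = exp 1 * exp (- (real m * y / 4))"
    by (simp flip: exp_add)
  also have "\<dots> \<le> 3 * exp (- (real m * y / 4))"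
    by (intro mult_right_mono exp_le) simp
  finally show ?thesis by (simp add: y_def mult_ac)
next
  case False
  define L where "L = \<sigma> * sqrt (real n)"
  have L: "0 < L" unfolding L_def using \<sigma>_pos n_pos by simp
  have "t * L \<le> 1" using False L by (simp add: L_def[symmetric] field_simps)
  then have "(t * L)\<^sup>2 \<le> 1" using t L by (simp add: power_le_one)
  then have "\<sigma>\<^sup>2 * real n * t\<^sup>2 \<le> 1" by (simp add: L_def power_mult_distrib mult_ac)
  moreover have "\<sigma>\<^sup>2 * real m * t\<^sup>2 \<le> \<sigma>\<^sup>2 * real n * t\<^sup>2"
    using m(1) by (intro mult_right_mono mult_left_mono) auto
  ultimately have "- 1 / 4 \<le> - (\<sigma>\<^sup>2 * real m * t\<^sup>2 / 4)" by simp
  then have "3 / 4 \<le> exp (- (\<sigma>\<^sup>2 * real m * t\<^sup>2 / 4))"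
    using exp_ge_add_one_self[of "- (\<sigma>\<^sup>2 * real m * t\<^sup>2 / 4)"] by linarith
  moreover have "norm (char U t) ^ k \<le> 1"
    by (intro power_le_one U.cmod_char_le_1) simp
  ultimately show ?thesis by linarith
qed

section \<open>A local estimate with quadratic decay\<close>

text \<open>
  With \<open>y = (a t)^2\<close>, the three terms that \<open>char_moment_conv_power\<close> produces are at most \<open>1\<close>, \<open>1\<close> and
  \<open>y\<close> times \<open>3 a^2 exp(-y/4)\<close>. The constant is \<open>192 = 3 * 64\<close>.
\<close>

lemma norm_weighted_char_le:
  assumes t: "0 \<le> t" "t \<le> 1 / (4 * b)" and m: "m \<le> n"
    and a: "a = \<sigma> * sqrt (real m)"
  shows "norm (of_real (a\<^sup>2) * char_moment 0 (conv_power U m) t + char_moment 2 (conv_power U m) t)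
    \<le> 192 * a\<^sup>2 * (1 / (1 + (a * t)\<^sup>2))"
proof -
  define y where "y = (a * t)\<^sup>2"
  define E where "E = 3 * exp (- y / 4)"
  have a2: "a\<^sup>2 = real m * \<sigma>\<^sup>2" by (simp add: a power_mult_distrib)
  have y: "y = real m * (\<sigma>\<^sup>2 * t\<^sup>2)" "0 \<le> y" by (auto simp: y_def power_mult_distrib a2)
  have E: "0 \<le> E" by (simp add: E_def)
  have power: "norm (char U t) ^ k \<le> E" if "m \<le> k + 2" for k
    using norm_char_power_le[OF t m that] by (simp add: E_def y mult_ac)
  have m1: "norm (char_moment 1 U t) \<le> t * \<sigma>\<^sup>2"
    using U.norm_char_moment_1_le[OF square_integrable centred, of t] t variance_eq by simp
  have m2: "norm (char_moment 2 U t) \<le> \<sigma>\<^sup>2"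
    using U.norm_char_moment_2_le[of t] variance_eq by simp
  have 0: "norm (of_real (a\<^sup>2) * char U t ^ m) \<le> a\<^sup>2 * E"
    using power[of m] by (simp add: norm_mult norm_power mult_left_mono)
  have 1: "norm (of_nat m * char_moment 2 U t * char U t ^ (m - 1)) \<le> real m * \<sigma>\<^sup>2 * E"
    unfolding norm_mult norm_power norm_of_nat
    by (intro mult_mono m2 power mult_left_mono mult_nonneg_nonneg) (auto simp: E)
  have 2: "norm (of_nat (m * (m - 1)) * (char_moment 1 U t)\<^sup>2 * char U t ^ (m - 2))
      \<le> (real m * real m) * (t * \<sigma>\<^sup>2)\<^sup>2 * E"
    unfolding norm_mult norm_power norm_of_nat of_nat_mult
    by (intro mult_mono m1 power power_mono mult_nonneg_nonneg) (auto simp: E)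
  have "norm (of_real (a\<^sup>2) * char_moment 0 (conv_power U m) t + char_moment 2 (conv_power U m) t)
    \<le> a\<^sup>2 * E + (real m * \<sigma>\<^sup>2 * E + (real m * real m) * (t * \<sigma>\<^sup>2)\<^sup>2 * E)"
    unfolding char_moment_conv_power[OF U.real_distribution_axioms square_integrable]
    by (intro order_trans[OF norm_triangle_ineq] add_mono 0 1 2)
  also have "\<dots> = E * (a\<^sup>2 + real m * \<sigma>\<^sup>2 + (real m * \<sigma>\<^sup>2) * (real m * (\<sigma>\<^sup>2 * t\<^sup>2)))"
    by (simp add: power2_eq_square algebra_simps)
  also have "\<dots> = 3 * a\<^sup>2 * (exp (- y / 4) * (2 + y))"
    unfolding a2[symmetric] y(1)[symmetric] E_def by (simp add: algebra_simps)
  also have "\<dots> \<le> 3 * a\<^sup>2 * (64 / (1 + y))"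
    by (intro mult_left_mono exp_decay_le y) simp
  finally show ?thesis by (simp add: y_def)
qed

text \<open>
  The indicator of \<open>[x, x+b]\<close> is at most four times the Fejer kernel at \<open>T (s - x)\<close>. Exchanging
  the integrals over \<open>s\<close> and over the frequency bounds the mean of the weighted kernel by an average of the
  moduli in \<open>norm_weighted_char_le\<close>.
\<close>

lemma weighted_local_estimate:
  assumes m: "1 \<le> m" "m \<le> n" and a: "a = \<sigma> * sqrt (real m)"
  shows "(LINT s|conv_power U m. (a\<^sup>2 + s\<^sup>2) * indicator {x..x+b} s) \<le> 6144 * a * b"
proof -
  define P where "P = conv_power U m"
  interpret P: real_distribution P
    unfolding P_def by (intro real_distribution_conv_power U.real_distribution_axioms)
  have sq: "integrable P (\<lambda>s. s\<^sup>2)"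
    unfolding P_def by (intro integrable_square_conv_power U.real_distribution_axioms square_integrable)
  define T where "T = 1 / (4 * b)"
  have T: "0 < T" "T * b = 1 / 4" using width_pos by (auto simp: T_def)
  have a_pos: "0 < a" using m \<sigma>_pos by (simp add: a)
  define w where "w s = a\<^sup>2 + s\<^sup>2" for s
  have w: "0 \<le> w s" for s by (simp add: w_def)
  have [measurable]: "w \<in> borel_measurable borel" by (simp add: w_def[abs_def])
  have w_int: "integrable P w" unfolding w_def by (intro Bochner_Integration.integrable_add sq) simp
  \<comment> \<open>The weighted kernel before integration over the frequency \<open>u T\<close>.\<close>
  define K where "K s u = w s * ((1 - u) * cos (u * (T * (s - x))) * indicator {0..1} u)" for s u :: real
  interpret pair_sigma_finite P lborel ..
  have K_meas: "(\<lambda>(s, u). K s u) \<in> borel_measurable (P \<Otimes>\<^sub>M lborel)"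
    unfolding K_def by measurable
  have ind_le: "norm ((1 - u) * cos z * indicator {0..1} u) \<le> indicator {0..1} u" for u z :: real
    by (auto simp: indicator_def abs_mult intro!: mult_le_one)
  have dom: "integrable (P \<Otimes>\<^sub>M lborel) (\<lambda>(s, u). w s * indicator {0..1::real} u)"
  proof (rule Fubini_integrable)
    show "(\<lambda>(s, u). w s * indicator {0..1::real} u) \<in> borel_measurable (P \<Otimes>\<^sub>M lborel)"
      by measurable
    show "integrable P (\<lambda>s. LBINT u. norm (case (s, u) of (s, u) \<Rightarrow> w s * indicator {0..1::real} u))"
      using w_int w by (simp add: abs_mult)
    show "AE s in P. integrable lborel (\<lambda>u. case (s, u) of (s, u) \<Rightarrow> w s * indicator {0..1::real} u)"
      by simp
  qed
  have K_int: "integrable (P \<Otimes>\<^sub>M lborel) (\<lambda>(s, u). K s u)"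
    by (rule Bochner_Integration.integrable_bound[OF dom K_meas])
       (use w ind_le in \<open>auto simp: K_def abs_mult intro!: AE_I2 mult_left_mono\<close>)
  have K_eq: "(LBINT u. K s u) = w s * (LBINT u. (1 - u) * cos (u * (T * (s - x))) * indicator {0..1} u)" for s
    unfolding K_def by simp
  have K_bound: "indicator {x..x+b} s * w s \<le> 4 * (LBINT u. K s u)" for s
  proof (cases "s \<in> {x..x+b}")
    case True
    have "\<bar>T * (s - x)\<bar> \<le> T * b"
      using True T by (auto simp: abs_mult)
    then have "1 / 4 \<le> (LBINT u. (1 - u) * cos (u * (T * (s - x))) * indicator {0..1} u)"
      by (intro fejer_kernel_ge) (simp add: T)
    then have "w s * (1 / 4) \<le> (LBINT u. K s u)"
      unfolding K_eq by (intro mult_left_mono w)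
    then show ?thesis using True by simp
  next
    case False
    then show ?thesis using fejer_kernel_nonneg w by (simp add: K_eq)
  qed
  have "(LINT s|P. w s * indicator {x..x+b} s) \<le> (LINT s|P. 4 * (LBINT u. K s u))"
  proof (rule integral_mono)
    show "integrable P (\<lambda>s. w s * indicator {x..x+b} s)"
      by (rule Bochner_Integration.integrable_bound[OF w_int]) (auto simp: indicator_def)
    show "integrable P (\<lambda>s. 4 * (LBINT u. K s u))"
      using integrable_fst'[OF K_int] by simp
  qed (use K_bound in \<open>simp add: mult.commute\<close>)
  also have "\<dots> = 4 * (LBINT u. (LINT s|P. K s u))"
    using Fubini_integral[OF K_int] by simp
  also have "\<dots> \<le> 4 * (LBINT u. 192 * a\<^sup>2 * (1 / (1 + (a * T * u)\<^sup>2) * indicator {0..1} u))"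
  proof (intro mult_left_mono integral_mono)
    show "integrable lborel (\<lambda>u. LINT s|P. K s u)"
      using integrable_snd[OF K_int] by simp
    have "1 + (a * T * u)\<^sup>2 \<noteq> 0" for u
      by (metis add_nonneg_eq_0_iff zero_le_one zero_le_power2 zero_neq_one)
    then have "continuous_on {0..1} (\<lambda>u. 1 / (1 + (a * T * u)\<^sup>2))"
      by (intro continuous_intros) auto
    from integrable_Icc[OF this]
    show "integrable lborel (\<lambda>u. 192 * a\<^sup>2 * (1 / (1 + (a * T * u)\<^sup>2) * indicator {0..1} u))"
      by (intro integrable_mult_right) (simp add: mult.commute)
    fix u :: real
    show "(LINT s|P. K s u) \<le> 192 * a\<^sup>2 * (1 / (1 + (a * T * u)\<^sup>2) * indicator {0..1} u)"
    proof (cases "u \<in> {0..1}")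
      case True
      define t where "t = u * T"
      have t: "0 \<le> t" "t \<le> 1 / (4 * b)"
        using True T mult_right_mono[of u 1 T] by (auto simp: t_def T_def)
      define z where "z = of_real (a\<^sup>2) * char_moment 0 P t + char_moment 2 P t"
      have c0: "complex_integrable P (\<lambda>s. iexp (t * s))"
        using P.integrable_char_moment[OF sq, of 0 t] by simp
      have c2: "complex_integrable P (\<lambda>s. of_real (s\<^sup>2) * iexp (t * s))"
        using P.integrable_char_moment[OF sq, of 2 t] by simp
      have c: "complex_integrable P (\<lambda>s. of_real (w s) * iexp (t * s))"
        using c0 c2 by (simp add: w_def distrib_right)
      have "z = (CLINT s|P. of_real (w s) * iexp (t * s))"
        using c0 c2 by (simp add: z_def char_moment_def w_def distrib_right)
      \<comment> \<open>Centring at \<open>x\<close> only multiplies the transform by a number of modulus \<open>1\<close>.\<close>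
      then have "iexp (- t * x) * z = (CLINT s|P. iexp (- t * x) * (of_real (w s) * iexp (t * s)))"
        by simp
      also have "\<dots> = (CLINT s|P. of_real (w s) * iexp (t * (s - x)))"
        by (intro Bochner_Integration.integral_cong refl)
           (simp add: mult.left_commute right_diff_distrib flip: exp_add)
      finally have "Re (iexp (- t * x) * z) = Re (CLINT s|P. of_real (w s) * iexp (t * (s - x)))"
        by simp
      also have "\<dots> = (LINT s|P. Re (of_real (w s) * iexp (t * (s - x))))"
      proof (rule integral_Re[symmetric])
        show "complex_integrable P (\<lambda>s. of_real (w s) * iexp (t * (s - x)))"
          by (rule Bochner_Integration.integrable_bound[OF w_int]) (auto simp: norm_mult w)
      qed
      also have "\<dots> = (LINT s|P. w s * cos (t * (s - x)))"
        by (simp add: Re_exp)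
      finally have z: "(LINT s|P. w s * cos (t * (s - x))) = Re (iexp (- t * x) * z)" by simp
      have "(LINT s|P. K s u) = (1 - u) * (LINT s|P. w s * cos (t * (s - x)))"
        using True by (simp add: K_def t_def mult_ac flip: integral_mult_right_zero)
      also have "\<dots> \<le> (1 - u) * norm z"
      proof (rule mult_left_mono)
        have "Re (iexp (- t * x) * z) \<le> norm (iexp (- t * x) * z)" by (rule complex_Re_le_cmod)
        also have "\<dots> = norm z" unfolding norm_mult norm_exp_i_times by simp
        finally show "(LINT s|P. w s * cos (t * (s - x))) \<le> norm z" by (simp add: z)
      qed (use True in auto)
      also have "\<dots> \<le> 1 * norm z" using True by (intro mult_right_mono) auto
      also have "\<dots> \<le> 192 * a\<^sup>2 * (1 / (1 + (a * t)\<^sup>2))"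
        using norm_weighted_char_le[OF t m(2) a] by (simp add: z_def P_def)
      finally show ?thesis using True by (simp add: t_def mult_ac)
    qed (simp add: K_def)
  qed simp
  also have "\<dots> = 4 * (192 * a\<^sup>2 * (LBINT u. 1 / (1 + (a * T * u)\<^sup>2) * indicator {0..1} u))"
    by (simp only: integral_mult_right_zero)
  also have "\<dots> \<le> 4 * (192 * a\<^sup>2 * (2 / (a * T)))"
    by (intro mult_left_mono integral_cauchy_density_le) (use a_pos T in auto)
  also have "\<dots> = 6144 * a * b"
    using a_pos width_pos by (simp add: T_def power2_eq_square)
  finally show ?thesis by (simp add: P_def w_def)
qed

text \<open>
  If \<open>s \<in> [z, z+b]\<close> and \<open>b \<le> a\<close>, then \<open>a^2 + z^2 \<le> 3 (a^2 + s^2)\<close>, so the weight in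
  \<open>weighted_local_estimate\<close> can be taken out of the integral.
\<close>

lemma local_estimate:
  assumes m: "1 \<le> m" "m \<le> n" and a: "a = \<sigma> * sqrt (real m)" and b: "b \<le> a"
  shows "measure (conv_power U m) {z..z+b} \<le> 18432 * (b / a) * (1 / (1 + (z / a)\<^sup>2))"
proof -
  define P where "P = conv_power U m"
  interpret P: real_distribution P
    unfolding P_def by (intro real_distribution_conv_power U.real_distribution_axioms)
  have sq: "integrable P (\<lambda>s. s\<^sup>2)"
    unfolding P_def by (intro integrable_square_conv_power U.real_distribution_axioms square_integrable)
  have a_pos: "0 < a" using m \<sigma>_pos by (simp add: a)
  have pos: "0 < a\<^sup>2 + z\<^sup>2" using a_pos by (simp add: add_pos_nonneg)
  have "(a\<^sup>2 + z\<^sup>2) * measure P {z..z+b} = (LINT s|P. (a\<^sup>2 + z\<^sup>2) * indicator {z..z+b} s)"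
    by simp
  also have "\<dots> \<le> (LINT s|P. 3 * ((a\<^sup>2 + s\<^sup>2) * indicator {z..z+b} s))"
  proof (rule integral_mono)
    have "integrable P (\<lambda>s. a\<^sup>2 + s\<^sup>2)"
      by (intro Bochner_Integration.integrable_add sq) simp
    then have "integrable P (\<lambda>s. (a\<^sup>2 + s\<^sup>2) * indicator {z..z+b} s)"
      by (rule Bochner_Integration.integrable_bound) (auto simp: indicator_def)
    then show "integrable P (\<lambda>s. 3 * ((a\<^sup>2 + s\<^sup>2) * indicator {z..z+b} s))" by simp
    show "integrable P (\<lambda>s. (a\<^sup>2 + z\<^sup>2) * indicator {z..z+b} s)"
      by (simp add: P.emeasure_eq_measure)
    fix s
    show "(a\<^sup>2 + z\<^sup>2) * indicator {z..z+b} s \<le> 3 * ((a\<^sup>2 + s\<^sup>2) * indicator {z..z+b} s)"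
    proof (cases "s \<in> {z..z+b}")
      case True
      then have "(s - z)\<^sup>2 \<le> a\<^sup>2" using b by (intro power_mono) auto
      moreover have "z\<^sup>2 \<le> 2 * s\<^sup>2 + 2 * (s - z)\<^sup>2"
        using zero_le_power2[of "2 * s - z"] by (simp add: power2_eq_square algebra_simps)
      ultimately have "a\<^sup>2 + z\<^sup>2 \<le> 3 * (a\<^sup>2 + s\<^sup>2)"
        using zero_le_power2[of s] unfolding distrib_left by linarith
      then show ?thesis using True by simp
    qed simp
  qed
  also have "\<dots> \<le> 3 * (6144 * a * b)"
    using weighted_local_estimate[OF m a, of z] by (simp add: P_def)
  finally have "measure P {z..z+b} \<le> 18432 * a * b / (a\<^sup>2 + z\<^sup>2)"
    using pos by (simp add: pos_le_divide_eq mult_ac)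
  also have "\<dots> = 18432 * (b / a) * (1 / (1 + (z / a)\<^sup>2))"
  proof -
    have "1 + (z / a)\<^sup>2 = (a\<^sup>2 + z\<^sup>2) / a\<^sup>2"
      using a_pos by (simp add: power_divide add_divide_distrib)
    then show ?thesis using a_pos by (simp add: power2_eq_square)
  qed
  finally show ?thesis by (simp add: P_def)
qed

end

section \<open>The smoothing inequality\<close>

text \<open>
  Each new level \<open>2^j\<close> either catches \<open>z\<close>, and its weight then pays for the previous remainder, or
  shows \<open>|z| > 2^j\<close>, in which case the new remainder alone suffices.
\<close>

lemma inverse_quadratic_le_dyadic_sum:
  fixes z :: real
  shows "1 / (1 + z\<^sup>2) \<le> (\<Sum>j<N. 4 / 4 ^ j * indicator {- (2 ^ j)..2 ^ j} z) + 4 / 4 ^ N"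
proof (cases N)
  case 0
  have "1 / (1 + z\<^sup>2) \<le> 1" by (simp add: divide_le_eq_1 add_pos_nonneg)
  then show ?thesis using 0 by simp
next
  case (Suc N')
  have nonneg: "0 \<le> (\<Sum>j<M. 4 / 4 ^ j * indicator {- (2 ^ j)..2 ^ j} z :: real)" for M
    by (intro sum_nonneg) auto
  show ?thesis unfolding Suc
  proof (induction N')
    case 0
    have "1 / (1 + z\<^sup>2) \<le> 1" by (simp add: divide_le_eq_1 add_pos_nonneg)
    then show ?case by (simp add: indicator_def)
  next
    case (Suc M)
    show ?case
    proof (cases "\<bar>z\<bar> \<le> 2 ^ Suc M")
      case True
      then have ind: "indicator {- (2 ^ Suc M)..2 ^ Suc M} z = (1::real)"
        by (auto simp: indicator_def)
      have "(0::real) \<le> 4 / 4 ^ Suc (Suc M)" by simp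
      with Suc show ?thesis
        unfolding sum.lessThan_Suc[of _ "Suc M"] ind mult_1_right by linarith
    next
      case False
      then have "(2 ^ Suc M)\<^sup>2 \<le> \<bar>z\<bar>\<^sup>2" by (intro power_mono) auto
      moreover have "(2 ^ Suc M)\<^sup>2 = (4::real) ^ Suc M"
        by (simp add: power_mult[symmetric] mult.commute[of _ 2] power_mult)
      ultimately have "1 / (1 + z\<^sup>2) \<le> 1 / 4 ^ Suc M"
        by (intro divide_left_mono mult_pos_pos add_pos_nonneg) auto
      then show ?thesis using nonneg[of "Suc (Suc M)"] by simp
    qed
  qed
qed

text \<open>
  The interval \<open>|x - y| \<le> 2^j a\<close> has mass at most \<open>2^(j+1) Q(W,a)\<close> and weight \<open>4^(1-j)\<close>; the geometric series
  sums to \<open>16\<close>, and the remainder \<open>4^(1-N)\<close> tends to \<open>0\<close>.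
\<close>

lemma integral_inverse_quadratic_le:
  assumes W: "real_distribution W" and a: "0 < a"
  shows "(LINT y|W. 1 / (1 + ((x - y) / a)\<^sup>2)) \<le> 16 * concentration W a"
proof -
  interpret real_distribution W by fact
  define Q where "Q = concentration W a"
  have Q: "0 \<le> Q" unfolding Q_def by (rule concentration_nonneg) fact
  define A where "A j = {x - 2 ^ j * a..x + 2 ^ j * a}" for j :: nat
  have ind: "indicator {- (2 ^ j)..2 ^ j} ((x - y) / a) = (indicat_real (A j) y :: real)" for j y
    using a by (auto simp: A_def indicator_def field_simps)
  have A: "measure W (A j) \<le> 2 * 2 ^ j * Q" for j
  proof -
    have "A j = {x - 2 ^ j * a..(x - 2 ^ j * a) + real (2 * 2 ^ j) * a}"
      by (auto simp: A_def)
    then have "measure W (A j) \<le> max 1 (real (2 * 2 ^ j)) * Q"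
      using concentration_multiple[OF W, of a "x - 2 ^ j * a" "2 * 2 ^ j"] a by (simp add: Q_def)
    moreover have "(1::real) \<le> 2 * 2 ^ j"
      using one_le_power[of "2::real" j] by linarith
    ultimately show ?thesis by (simp add: max_def)
  qed
  have geo: "(\<Sum>j<N. (1 / 2) ^ j) = 2 * (1 - (1 / 2 :: real) ^ N)" for N
    by (subst sum_gp_strict) simp
  have bound: "(LINT y|W. 1 / (1 + ((x - y) / a)\<^sup>2)) \<le> 16 * Q + 4 / 4 ^ N" for N
  proof -
    have int: "integrable W (\<lambda>y. 4 / 4 ^ j * indicat_real (A j) y :: real)" for j
      by (simp add: A_def emeasure_eq_measure)
    have "(LINT y|W. 1 / (1 + ((x - y) / a)\<^sup>2))
        \<le> (LINT y|W. (\<Sum>j<N. 4 / 4 ^ j * indicat_real (A j) y) + 4 / 4 ^ N)"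
    proof (rule integral_mono')
      show "integrable W (\<lambda>y. (\<Sum>j<N. 4 / 4 ^ j * indicat_real (A j) y) + 4 / 4 ^ N)"
        using int by (intro Bochner_Integration.integrable_add Bochner_Integration.integrable_sum) auto
      show "1 / (1 + ((x - y) / a)\<^sup>2) \<le> (\<Sum>j<N. 4 / 4 ^ j * indicat_real (A j) y) + 4 / 4 ^ N" for y
        using inverse_quadratic_le_dyadic_sum[of "(x - y) / a" N] unfolding ind .
      show "0 \<le> (\<Sum>j<N. 4 / 4 ^ j * indicat_real (A j) y) + 4 / 4 ^ N" for y
        by (intro add_nonneg_nonneg sum_nonneg) auto
    qed
    also have "\<dots> = (\<Sum>j<N. 4 / 4 ^ j * measure W (A j)) + 4 / 4 ^ N"
    proof -
      have "(LINT y|W. (\<Sum>j<N. 4 / 4 ^ j * indicat_real (A j) y) + 4 / 4 ^ N)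
          = (LINT y|W. (\<Sum>j<N. 4 / 4 ^ j * indicat_real (A j) y)) + (LINT y|W. 4 / 4 ^ N)"
        using int by (intro Bochner_Integration.integral_add Bochner_Integration.integrable_sum) auto
      also have "(LINT y|W. (\<Sum>j<N. 4 / 4 ^ j * indicat_real (A j) y))
          = (\<Sum>j<N. (LINT y|W. 4 / 4 ^ j * indicat_real (A j) y))"
        using int by (intro Bochner_Integration.integral_sum)
      also have "\<dots> = (\<Sum>j<N. 4 / 4 ^ j * measure W (A j))"
        by (simp add: A_def)
      finally show ?thesis using prob_space by simp
    qed
    also have "(\<Sum>j<N. 4 / 4 ^ j * measure W (A j)) \<le> (\<Sum>j<N. 8 * Q * (1 / 2) ^ j)"
    proof (rule sum_mono)
      fix j
      have "4 / 4 ^ j * measure W (A j) \<le> 4 / 4 ^ j * (2 * 2 ^ j * Q)"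
        by (intro mult_left_mono A) simp
      also have "(4::real) ^ j = 2 ^ j * 2 ^ j" by (simp flip: power_mult_distrib)
      then have "4 / 4 ^ j * (2 * 2 ^ j * Q) = 8 * Q * (1 / 2) ^ j"
        by (simp add: power_one_over field_simps)
      finally show "4 / 4 ^ j * measure W (A j) \<le> 8 * Q * (1 / 2) ^ j" .
    qed
    also have "(\<Sum>j<N. 8 * Q * (1 / 2) ^ j) = 8 * Q * (2 * (1 - (1 / 2) ^ N))"
      unfolding sum_distrib_left[symmetric] geo ..
    also have "\<dots> \<le> 16 * Q" using Q by (simp add: algebra_simps)
    finally show ?thesis by simp
  qed
  have "(\<lambda>N. 16 * Q + 4 * (1 / 4) ^ N) \<longlonglongrightarrow> 16 * Q + 4 * 0"
    by (rule tendsto_add[OF tendsto_const tendsto_mult[OF tendsto_const LIMSEQ_power_zero]]) simp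
  then have "(\<lambda>N. 16 * Q + 4 / 4 ^ N) \<longlonglongrightarrow> 16 * Q"
    by (simp add: power_one_over)
  then show ?thesis unfolding Q_def[symmetric]
    by (rule LIMSEQ_le_const) (use bound in auto)
qed

context centred_summand
begin

text \<open>
  For \<open>b \<le> a\<close> the local estimate is integrated over the position of the \<open>W\<close>-summand. For \<open>b > a\<close> there is
  nothing to smooth: an interval of length \<open>b\<close> is covered by at most \<open>1 + b/a \<le> 2 b/a\<close> intervals of length \<open>a\<close>.
\<close>

lemma concentration_smoothing:
  assumes W: "real_distribution W" and m: "1 \<le> m" "m \<le> n"
  shows "concentration (W \<star> conv_power U m) b
    \<le> 300000 * b / (\<sigma> * sqrt (real m)) * concentration W (\<sigma> * sqrt (real m))"
proof -
  interpret W: real_distribution W by fact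
  have P: "real_distribution (conv_power U m)"
    by (intro real_distribution_conv_power U.real_distribution_axioms)
  interpret P: real_distribution "conv_power U m" by (rule P)
  define a where "a = \<sigma> * sqrt (real m)"
  have a_pos: "0 < a" using m \<sigma>_pos by (simp add: a_def)
  have Q: "0 \<le> concentration W a" by (rule concentration_nonneg) fact
  show ?thesis unfolding a_def[symmetric]
  proof (cases "b \<le> a")
    case True
    show "concentration (W \<star> conv_power U m) b \<le> 300000 * b / a * concentration W a"
    proof (rule concentration_le)
      fix x
      have "measure (W \<star> conv_power U m) {x..x+b}
          = (LINT y|W. measure (conv_power U m) {x - y..x - y + b})"
        by (rule measure_convolution_interval) fact+
      also have "\<dots> \<le> (LINT y|W. 18432 * (b / a) * (1 / (1 + ((x - y) / a)\<^sup>2)))"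
      proof (rule integral_mono')
        show "integrable W (\<lambda>y. 18432 * (b / a) * (1 / (1 + ((x - y) / a)\<^sup>2)))"
        proof (intro integrable_mult_right W.integrable_const_bound[where B=1])
          show "AE y in W. norm (1 / (1 + ((x - y) / a)\<^sup>2)) \<le> 1"
            by (auto simp: abs_le_iff divide_le_eq_1 add_pos_nonneg)
        qed simp
      qed (use local_estimate[OF m a_def True] width_pos a_pos in auto)
      also have "\<dots> = 18432 * (b / a) * (LINT y|W. 1 / (1 + ((x - y) / a)\<^sup>2))"
        by (rule integral_mult_right_zero)
      also have "\<dots> \<le> 18432 * (b / a) * (16 * concentration W a)"
        using width_pos a_pos by (intro mult_left_mono integral_inverse_quadratic_le W) auto
      also have "\<dots> = 294912 * (b / a * concentration W a)" by simp
      also have "\<dots> \<le> 300000 * (b / a * concentration W a)"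
        using width_pos a_pos Q by (intro mult_right_mono) auto
      finally show "measure (W \<star> conv_power U m) {x..x+b} \<le> 300000 * b / a * concentration W a"
        by simp
    qed
  next
    case False
    have "concentration (W \<star> conv_power U m) b \<le> concentration W b"
      by (rule concentration_convolution[OF W P])
    also have "\<dots> \<le> (1 + b / a) * concentration W a"
      using width_pos a_pos by (intro concentration_scale W) auto
    also have "\<dots> \<le> 300000 * b / a * concentration W a"
    proof (intro mult_right_mono Q)
      have "1 \<le> b / a" using False a_pos by simp
      then have "1 + b / a \<le> 300000 * (b / a)" by linarith
      then show "1 + b / a \<le> 300000 * b / a" by simp
    qed
    finally show "concentration (W \<star> conv_power U m) b \<le> 300000 * b / a * concentration W a" .
  qed
qed

end

section \<open>Mixtures and the binomial distribution\<close>

lemma measure_convolution_mixture: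
  assumes F: "real_distribution F" and U: "real_distribution U" and V: "real_distribution V"
    and G: "real_distribution G"
    and p: "0 < p" "p < 1"
    and mix: "\<forall>A\<in>sets borel. measure F A = (1 - p) * measure U A + p * measure V A"
  shows "measure (G \<star> F) {x..x+b} = (1 - p) * measure (G \<star> U) {x..x+b} + p * measure (G \<star> V) {x..x+b}"
proof -
  interpret G: real_distribution G by fact
  have int: "integrable G (\<lambda>y. measure N {x - y..x - y + b})" if N: "real_distribution N" for N
  proof -
    interpret N: real_distribution N by fact
    have "(\<lambda>y. emeasure N (Pair y -` {(y, z). x - y \<le> z \<and> z \<le> x - y + b})) \<in> borel_measurable borel"
    proof (rule N.measurable_emeasure_Pair)
      have "{(y, z). x - y \<le> z \<and> z \<le> x - y + b}
          = {q \<in> space (borel \<Otimes>\<^sub>M N). x - fst q \<le> snd q \<and> snd q \<le> x - fst q + b}"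
        by (auto simp: space_pair_measure)
      also have "\<dots> \<in> sets (borel \<Otimes>\<^sub>M N)" by measurable
      finally show "{(y, z). x - y \<le> z \<and> z \<le> x - y + b} \<in> sets (borel \<Otimes>\<^sub>M N)" .
    qed
    moreover have "Pair y -` {(y, z). x - y \<le> z \<and> z \<le> x - y + b} = {x - y..x - y + b}" for y
      by auto
    ultimately have "(\<lambda>y. emeasure N {x - y..x - y + b}) \<in> borel_measurable borel" by (simp only:)
    then have "(\<lambda>y. measure N {x - y..x - y + b}) \<in> borel_measurable borel"
      unfolding measure_def by measurable
    then show ?thesis
      by (intro G.integrable_const_bound[where B=1]) auto
  qed
  have "measure (G \<star> F) {x..x+b} = (LINT y|G. (1 - p) * measure U {x - y..x - y + b} + p * measure V {x - y..x - y + b})"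
    using mix by (simp add: measure_convolution_interval[OF G F])
  also have "\<dots> = (1 - p) * measure (G \<star> U) {x..x+b} + p * measure (G \<star> V) {x..x+b}"
    by (simp add: int U V measure_convolution_interval[OF G])
  finally show ?thesis .
qed

lemma expectation_binomial_Suc:
  fixes g :: "nat \<Rightarrow> real"
  assumes "p \<in> {0..1}"
  shows "measure_pmf.expectation (binomial_pmf (Suc n) p) g =
    (1 - p) * measure_pmf.expectation (binomial_pmf n p) g
      + p * measure_pmf.expectation (binomial_pmf n p) (\<lambda>k. g (Suc k))"
  unfolding binomial_pmf_Suc[OF assms] using assms
  by (subst pmf_expectation_bind[where A=UNIV])
     (auto simp: pmf_expectation_bind[where A="{..n}"] set_pmf_binomial_eq UNIV_bool expectation_binomial_pmf')

text \<open>
  Each factor \<open>F\<close> is split into \<open>U\<close> or \<open>V\<close>, one at a time, absorbing the chosen factor into \<open>G\<close>; this is why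
  \<open>G\<close> is generalised in the induction.
\<close>

lemma concentration_mixture_power_le:
  assumes F: "real_distribution F" and U: "real_distribution U" and V: "real_distribution V"
    and G: "real_distribution G"
    and p: "0 < p" "p < 1"
    and mix: "\<forall>A\<in>sets borel. measure F A = (1 - p) * measure U A + p * measure V A"
  shows "concentration (G \<star> conv_power F n) b \<le>
    measure_pmf.expectation (binomial_pmf n p)
      (\<lambda>k. concentration ((G \<star> conv_power U (n - k)) \<star> conv_power V k) b)"
  using G
proof (induction n arbitrary: G)
  case 0
  have R: "real_distribution (return borel (0::real))"
    using real_distribution_conv_power[OF F, of 0] by simp
  have "(return borel (0::real) \<star> return borel 0) = return borel 0"
    using conv_power_add[OF F, of 0 0] by simp
  with 0 p show ?case
    by (simp add: binomial_pmf_0 convolution_assoc R)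
next
  case (Suc n)
  note G = \<open>real_distribution G\<close>
  note R = real_distribution_convolution real_distribution_conv_power F U V G
  have "concentration (G \<star> conv_power F (Suc n)) b
      \<le> (1 - p) * concentration ((G \<star> U) \<star> conv_power F n) b + p * concentration ((G \<star> V) \<star> conv_power F n) b"
  proof (rule concentration_le)
    fix x
    have "(G \<star> conv_power F (Suc n)) = ((G \<star> conv_power F n) \<star> F)"
      by (simp add: convolution_right_comm[symmetric] convolution_assoc[symmetric] R)
    then have "measure (G \<star> conv_power F (Suc n)) {x..x+b}
        = (1 - p) * measure ((G \<star> conv_power F n) \<star> U) {x..x+b}
          + p * measure ((G \<star> conv_power F n) \<star> V) {x..x+b}"
      by (simp add: measure_convolution_mixture[OF F U V _ p mix] R del: conv_power.simps)
    also have "\<dots> = (1 - p) * measure ((G \<star> U) \<star> conv_power F n) {x..x+b}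
          + p * measure ((G \<star> V) \<star> conv_power F n) {x..x+b}"
      by (simp add: convolution_right_comm[of G "conv_power F n"] R)
    also have "\<dots> \<le> (1 - p) * concentration ((G \<star> U) \<star> conv_power F n) b
          + p * concentration ((G \<star> V) \<star> conv_power F n) b"
      using p by (intro add_mono mult_left_mono measure_le_concentration R) auto
    finally show "measure (G \<star> conv_power F (Suc n)) {x..x+b} \<le> \<dots>" .
  qed
  also have "\<dots> \<le> (1 - p) * measure_pmf.expectation (binomial_pmf n p)
        (\<lambda>k. concentration (((G \<star> U) \<star> conv_power U (n - k)) \<star> conv_power V k) b)
      + p * measure_pmf.expectation (binomial_pmf n p)
        (\<lambda>k. concentration (((G \<star> V) \<star> conv_power U (n - k)) \<star> conv_power V k) b)"
    using p by (intro add_mono mult_left_mono Suc.IH R) auto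
  also have "measure_pmf.expectation (binomial_pmf n p)
        (\<lambda>k. concentration (((G \<star> U) \<star> conv_power U (n - k)) \<star> conv_power V k) b)
      = measure_pmf.expectation (binomial_pmf n p)
        (\<lambda>k. concentration ((G \<star> conv_power U (Suc n - k)) \<star> conv_power V k) b)"
  proof (intro integral_cong_AE)
    show "AE k in binomial_pmf n p. concentration (((G \<star> U) \<star> conv_power U (n - k)) \<star> conv_power V k) b
      = concentration ((G \<star> conv_power U (Suc n - k)) \<star> conv_power V k) b"
      unfolding AE_measure_pmf_iff
      using p by (auto simp: Suc_diff_le convolution_assoc[of G U] R)
  qed auto
  also have "(\<lambda>k. concentration (((G \<star> V) \<star> conv_power U (n - k)) \<star> conv_power V k) b)
      = (\<lambda>k. concentration ((G \<star> conv_power U (Suc n - Suc k)) \<star> conv_power V (Suc k)) b)"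
    by (simp add: convolution_right_comm[of G V] convolution_assoc[of "G \<star> _" V] R)
  finally show ?case
    using p by (simp add: expectation_binomial_Suc del: conv_power.simps)
qed

text \<open>
  Absorption of \<open>1/(n - k + 1)\<close> into the binomial coefficient turns the sum into the one for
  \<open>n + 1\<close> trials with one term missing.
\<close>

lemma expectation_inverse_binomial_le:
  assumes p: "0 < p" "p < 1"
  shows "measure_pmf.expectation (binomial_pmf n p) (\<lambda>k. 1 / real (n - k + 1)) \<le> 1 / (real (n + 1) * (1 - p))"
proof -
  have eq: "real (n choose k) * p ^ k * (1 - p) ^ (n - k) * (1 / real (n - k + 1))
      = real (Suc n choose k) * p ^ k * (1 - p) ^ (Suc n - k) / (real (n + 1) * (1 - p))" if "k \<le> n" for k
  proof -
    have "(Suc n - k) * (Suc n choose k) = Suc n * (n choose k)"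
      using binomial_absorb_comp[of "Suc n" k] by simp
    then have "real (Suc n - k) * real (Suc n choose k) = real (Suc n) * real (n choose k)"
      by (metis of_nat_mult)
    moreover have "Suc n - k = Suc (n - k)" using that by simp
    ultimately have "real (Suc n choose k) = real (n + 1) * real (n choose k) / real (n - k + 1)"
      by (simp add: field_simps)
    moreover have "(1 - p) ^ (Suc n - k) = (1 - p) * (1 - p) ^ (n - k)"
      using that by (simp add: Suc_diff_le)
    ultimately show ?thesis using p by simp
  qed
  have "measure_pmf.expectation (binomial_pmf n p) (\<lambda>k. 1 / real (n - k + 1))
      = (\<Sum>k\<le>n. real (n choose k) * p ^ k * (1 - p) ^ (n - k) * (1 / real (n - k + 1)))"
    using p by (subst expectation_binomial_pmf') auto
  also have "\<dots> = (\<Sum>k\<le>n. real (Suc n choose k) * p ^ k * (1 - p) ^ (Suc n - k) / (real (n + 1) * (1 - p)))"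
    by (intro sum.cong refl eq) auto
  also have "\<dots> \<le> (\<Sum>k\<le>Suc n. real (Suc n choose k) * p ^ k * (1 - p) ^ (Suc n - k) / (real (n + 1) * (1 - p)))"
    using p by (intro sum_mono2) auto
  also have "\<dots> = (p + (1 - p)) ^ Suc n / (real (n + 1) * (1 - p))"
    unfolding sum_divide_distrib[symmetric] by (subst binomial_ring) simp
  finally show ?thesis by simp
qed

text \<open>
  By the inequality between the arithmetic and geometric means, \<open>1/sqrt M \<le> q/(2 M) + 1/(2 q)\<close> for \<open>q > 0\<close>,
  and the choice \<open>q = sqrt (n (1 - p))\<close> balances the two means, because \<open>1/(2 M) \<le> 1/(n - k + 1)\<close> for
  \<open>M = max 1 (n - k)\<close>. The maximum with \<open>1\<close> covers the term \<open>k = n\<close>.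
\<close>

lemma expectation_inverse_sqrt_binomial_le:
  assumes p: "0 < p" "p < 1" and n: "1 \<le> n"
  shows "measure_pmf.expectation (binomial_pmf n p) (\<lambda>k. 1 / sqrt (real (max 1 (n - k))))
    \<le> 3 / (2 * sqrt (real n * (1 - p)))"
proof -
  define q where "q = sqrt (real n * (1 - p))"
  have q: "0 < q" "q\<^sup>2 = real n * (1 - p)" using p n by (auto simp: q_def)
  have int: "integrable (binomial_pmf n p) f" for f :: "nat \<Rightarrow> real"
    using p by (intro integrable_binomial_pmf) auto
  have "measure_pmf.expectation (binomial_pmf n p) (\<lambda>k. 1 / sqrt (real (max 1 (n - k))))
    \<le> measure_pmf.expectation (binomial_pmf n p) (\<lambda>k. q * (1 / real (n - k + 1)) + 1 / (2 * q))"
  proof (intro integral_mono int)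
    fix k
    define M where "M = real (max 1 (n - k))"
    have M: "1 \<le> M" "real (n - k + 1) \<le> 2 * M" by (auto simp: M_def)
    define h where "h = 1 / sqrt M"
    have h: "h\<^sup>2 = 1 / M" using M by (simp add: h_def power_divide)
    \<comment> \<open>The inequality between the two means, from \<open>(q h - 1)^2 \<ge> 0\<close>.\<close>
    have "2 * (q * h) \<le> (q * h)\<^sup>2 + 1"
      using zero_le_power2[of "q * h - 1"] by (simp add: power2_diff)
    then have "q * h \<le> q * (q * h\<^sup>2 / 2 + 1 / (2 * q))"
      using q by (simp add: algebra_simps power2_eq_square)
    then have "h \<le> q * h\<^sup>2 / 2 + 1 / (2 * q)"
      using q(1) by (rule mult_left_le_imp_le)
    also have "q * h\<^sup>2 / 2 = q * (1 / (2 * M))" by (simp add: h)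
    also have "\<dots> \<le> q * (1 / real (n - k + 1))"
      using q M by (intro mult_left_mono divide_left_mono) auto
    finally show "1 / sqrt (real (max 1 (n - k))) \<le> q * (1 / real (n - k + 1)) + 1 / (2 * q)"
      by (simp add: h_def M_def)
  qed
  also have "\<dots> = q * measure_pmf.expectation (binomial_pmf n p) (\<lambda>k. 1 / real (n - k + 1)) + 1 / (2 * q)"
    by (subst Bochner_Integration.integral_add[OF int int], subst integral_mult_right_zero) simp
  also have "\<dots> \<le> q * (1 / q\<^sup>2) + 1 / (2 * q)"
  proof (intro add_right_mono mult_left_mono)
    have "1 / (real (n + 1) * (1 - p)) \<le> 1 / (real n * (1 - p))"
      using p n by (intro divide_left_mono mult_right_mono) auto
    then show "measure_pmf.expectation (binomial_pmf n p) (\<lambda>k. 1 / real (n - k + 1)) \<le> 1 / q\<^sup>2"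
      using expectation_inverse_binomial_le[OF p, of n] by (simp add: q(2))
  qed (use q in auto)
  also have "\<dots> = 3 / (2 * q)" using q(1) by (simp add: field_simps power2_eq_square)
  finally show ?thesis by (simp add: q_def)
qed

section \<open>A fixed number of summands from V\<close>

context centred_summand
begin

lemma concentration_replace_le:
  assumes W: "real_distribution W" and m: "1 \<le> m" "m \<le> n"
  shows "concentration (W \<star> conv_power U m) b
    \<le> 300000 * b / (\<sigma> * sqrt (real m)) * concentration W (\<sigma> * sqrt (real n))"
proof -
  have "concentration W (\<sigma> * sqrt (real m)) \<le> concentration W (\<sigma> * sqrt (real n))"
    using m \<sigma>_pos by (intro concentration_mono W) simp
  then show ?thesis
    using width_pos \<sigma>_pos
    by (intro order_trans[OF concentration_smoothing[OF W m]] mult_left_mono)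
       auto
qed

lemma swap_summands:
  assumes H: "real_distribution H" and V: "real_distribution V"
  shows "((H \<star> conv_power U i) \<star> conv_power V j) = ((H \<star> conv_power V j) \<star> conv_power U i)"
  by (intro convolution_right_comm H real_distribution_conv_power V U.real_distribution_axioms)

text \<open>
  Here \<open>V\<close> is discarded altogether: at least \<open>n - r\<close> factors \<open>U\<close> remain to smooth \<open>H\<close>. The
  constant \<open>450000\<close> is \<open>3/2\<close> times the one of \<open>concentration_smoothing\<close>, as \<open>two_range_bound\<close> requires.
\<close>

lemma few_replacements_le:
  assumes H: "real_distribution H" and V: "real_distribution V" and k: "k < r" and r: "r < n"
  shows "concentration ((H \<star> conv_power U (n - k)) \<star> conv_power V k) b
    \<le> min 1 (450000 * b / (\<sigma> * sqrt (real (n - r))) * concentration H (\<sigma> * sqrt (real n)))"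
proof (rule min.boundedI)
  note R = real_distribution_convolution real_distribution_conv_power H V U.real_distribution_axioms
  show "concentration ((H \<star> conv_power U (n - k)) \<star> conv_power V k) b \<le> 1"
    by (intro concentration_le_1 R)
  have "concentration ((H \<star> conv_power U (n - k)) \<star> conv_power V k) b \<le> concentration (H \<star> conv_power U (n - k)) b"
    by (intro concentration_convolution R)
  also have "\<dots> \<le> 300000 * b / (\<sigma> * sqrt (real (n - k))) * concentration H (\<sigma> * sqrt (real n))"
    using k r by (intro concentration_replace_le R) auto
  also have "\<dots> \<le> 450000 * b / (\<sigma> * sqrt (real (n - r))) * concentration H (\<sigma> * sqrt (real n))"
    using width_pos \<sigma>_pos k r
    by (intro mult_right_mono frac_le mult_left_mono concentration_nonneg R) auto
  finally show "concentration ((H \<star> conv_power U (n - k)) \<star> conv_power V k) b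
    \<le> 450000 * b / (\<sigma> * sqrt (real (n - r))) * concentration H (\<sigma> * sqrt (real n))" .
qed

text \<open>
  All but \<open>r\<close> factors \<open>V\<close> are discarded. For \<open>k = n\<close> no factor \<open>U\<close> is left for smoothing; the bound is
  then the trivial one, as \<open>b\<close> is at least of order \<open>\<sigma>\<close>.
\<close>

lemma many_replacements_le:
  assumes H: "real_distribution H" and V: "real_distribution V" and k: "r \<le> k" "k \<le> n"
  shows "concentration ((H \<star> conv_power U (n - k)) \<star> conv_power V k) b
    \<le> 300000 * b / (\<sigma> * sqrt (real (max 1 (n - k)))) * concentration (H \<star> conv_power V r) (\<sigma> * sqrt (real n))"
proof -
  note R = real_distribution_convolution real_distribution_conv_power H V U.real_distribution_axioms
  define W where "W = (H \<star> conv_power V r)"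
  have W: "real_distribution W" unfolding W_def by (intro R)
  have "(H \<star> conv_power V k) = (W \<star> conv_power V (k - r))"
    using conv_power_add[OF V, of r "k - r"] k by (simp add: W_def convolution_assoc R)
  then have "((H \<star> conv_power U (n - k)) \<star> conv_power V k) = ((W \<star> conv_power U (n - k)) \<star> conv_power V (k - r))"
    by (simp add: swap_summands H V W)
  then have "concentration ((H \<star> conv_power U (n - k)) \<star> conv_power V k) b \<le> concentration (W \<star> conv_power U (n - k)) b"
    by (simp add: concentration_convolution R W)
  also have "\<dots> \<le> 300000 * b / (\<sigma> * sqrt (real (max 1 (n - k)))) * concentration W (\<sigma> * sqrt (real n))"
  proof (cases "k = n")
    case True
    have "concentration (W \<star> conv_power U (n - k)) b \<le> concentration W b"
      by (intro concentration_convolution R W)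
    also have "\<dots> \<le> (1 + b / (\<sigma> * sqrt (real n))) * concentration W (\<sigma> * sqrt (real n))"
      using \<sigma>_pos n_pos width_pos by (intro concentration_scale W) auto
    also have "\<dots> \<le> 300000 * b / \<sigma> * concentration W (\<sigma> * sqrt (real n))"
    proof (intro mult_right_mono concentration_nonneg W)
      have "b / (\<sigma> * sqrt (real n)) \<le> b / \<sigma>"
        using width_pos \<sigma>_pos n_pos \<sigma>_le by (intro divide_left_mono) auto
      moreover have "3 / 8 \<le> b / \<sigma>" using width_ge_\<sigma> \<sigma>_pos by (simp add: pos_le_divide_eq)
      ultimately have "1 + b / (\<sigma> * sqrt (real n)) \<le> 300000 * (b / \<sigma>)" by linarith
      then show "1 + b / (\<sigma> * sqrt (real n)) \<le> 300000 * b / \<sigma>"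
        by simp
    qed
    finally show ?thesis using True by simp
  next
    case False
    then have "max 1 (n - k) = n - k" using k by auto
    with False k show ?thesis using concentration_replace_le[OF W, of "n - k"] by auto
  qed
  finally show ?thesis by (simp add: W_def)
qed

end

section \<open>Averaging over the number of summands from V\<close>

locale mixture_summand = centred_summand U \<sigma> b n
  for U :: "real measure" and \<sigma> b :: real and n :: nat +
  fixes F V H :: "real measure" and p :: real and r s :: nat
  assumes p: "0 < p" "p < 1"
    and F: "real_distribution F" and V: "real_distribution V" and H: "real_distribution H"
    and mixture: "\<forall>A\<in>sets borel. measure F A = (1 - p) * measure U A + p * measure V A"
    and rs: "r < s" "s \<le> n"
begin

text \<open>
  The concentration when exactly \<open>k\<close> of the \<open>n\<close> factors \<open>F\<close> are replaced by \<open>V\<close> and the others by \<open>U\<close>.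
\<close>

abbreviation "replaced k \<equiv> concentration ((H \<star> conv_power U (n - k)) \<star> conv_power V k) b"

abbreviation "few_bound \<equiv>
  min 1 (450000 * b / (\<sigma> * sqrt (real (n - r))) * concentration H (\<sigma> * sqrt (real n)))"

lemma integrable_binomial: "integrable (binomial_pmf n p) (g :: nat \<Rightarrow> real)"
  using p by (intro integrable_binomial_pmf) auto

lemma expectation_binomial_mono:
  fixes g h :: "nat \<Rightarrow> real"
  assumes "\<And>k. k \<le> n \<Longrightarrow> g k \<le> h k"
  shows "measure_pmf.expectation (binomial_pmf n p) g \<le> measure_pmf.expectation (binomial_pmf n p) h"
  using p assms by (intro integral_mono_AE integrable_binomial) (auto simp: AE_measure_pmf_iff)

lemma concentration_power_le:
  "concentration (H \<star> conv_power F n) b \<le> measure_pmf.expectation (binomial_pmf n p) replaced"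
  by (intro concentration_mixture_power_le F V H U.real_distribution_axioms p mixture)

text \<open>
  The three ranges of \<open>\<mu>\<close> use \<open>few_replacements_le\<close>, \<open>concentration_smoothing\<close> with
  \<open>W = H V^\<mu>\<close>, and no estimate at all; \<open>\<mu> < s \<le> n\<close> guarantees that a factor \<open>U\<close> is available in the middle one.
\<close>

lemma three_range_bound:
  "concentration (H \<star> conv_power F n) b
    \<le> measure_pmf.expectation (binomial_pmf n p) (\<lambda>\<mu>.
         450000 * b / (\<sigma> * sqrt (real (n - \<mu>))) *
         concentration (H \<star> conv_power V \<mu>) (\<sigma> * sqrt (real (n - \<mu>))) * indicator {r..<s} \<mu>)
     + measure_pmf.expectation (binomial_pmf n p) (\<lambda>\<mu>. replaced \<mu> * indicator {s..} \<mu>)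
     + few_bound * measure_pmf.prob (binomial_pmf n p) {\<mu>. \<mu> < r}"
proof -
  note R = real_distribution_convolution real_distribution_conv_power H V
  define g1 where "g1 \<mu> = 450000 * b / (\<sigma> * sqrt (real (n - \<mu>))) *
         concentration (H \<star> conv_power V \<mu>) (\<sigma> * sqrt (real (n - \<mu>))) * indicator {r..<s} \<mu>" for \<mu>
  define g2 where "g2 \<mu> = replaced \<mu> * indicator {s..} \<mu>" for \<mu>
  define g3 where "g3 \<mu> = few_bound * indicator {\<mu>. \<mu> < r} \<mu>" for \<mu>
  have "concentration (H \<star> conv_power F n) b \<le> measure_pmf.expectation (binomial_pmf n p) replaced"
    by (rule concentration_power_le)
  also have "\<dots> \<le> measure_pmf.expectation (binomial_pmf n p) (\<lambda>\<mu>. g1 \<mu> + g2 \<mu> + g3 \<mu>)"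
  proof (rule expectation_binomial_mono)
    fix k assume k: "k \<le> n"
    consider "k < r" | "r \<le> k" "k < s" | "s \<le> k" by linarith
    then show "replaced k \<le> g1 k + g2 k + g3 k"
    proof cases
      case 1
      have "replaced k \<le> few_bound"
        using rs by (intro few_replacements_le H V 1) auto
      then show ?thesis using 1 rs by (simp add: g1_def g2_def g3_def)
    next
      case 2
      have "replaced k = concentration ((H \<star> conv_power V k) \<star> conv_power U (n - k)) b"
        by (simp add: swap_summands H V)
      also have "\<dots> \<le> 300000 * b / (\<sigma> * sqrt (real (n - k))) *
          concentration (H \<star> conv_power V k) (\<sigma> * sqrt (real (n - k)))"
        using 2 rs by (intro concentration_smoothing R) auto
      also have "\<dots> \<le> 450000 * b / (\<sigma> * sqrt (real (n - k))) *
          concentration (H \<star> conv_power V k) (\<sigma> * sqrt (real (n - k)))"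
        using width_pos \<sigma>_pos
        by (intro mult_right_mono divide_right_mono concentration_nonneg R) auto
      also have "\<dots> = g1 k" using 2 by (simp add: g1_def)
      finally show ?thesis using 2 by (simp add: g2_def g3_def)
    next
      case 3
      then show ?thesis using rs by (simp add: g1_def g2_def g3_def)
    qed
  qed
  also have "\<dots> = measure_pmf.expectation (binomial_pmf n p) g1 + measure_pmf.expectation (binomial_pmf n p) g2
      + measure_pmf.expectation (binomial_pmf n p) g3"
    by (simp add: integrable_binomial)
  also have "measure_pmf.expectation (binomial_pmf n p) g3
      = few_bound * measure_pmf.prob (binomial_pmf n p) {\<mu>. \<mu> < r}"
    unfolding g3_def by (subst integral_mult_right_zero) simp
  finally show ?thesis by (simp add: g1_def g2_def)
qed

text \<open>
  For \<open>\<mu> \<ge> r\<close> the dependence on \<open>\<mu>\<close> is only through \<open>1 / sqrt (max 1 (n - \<mu>))\<close>, whose mean is at most \<open>3/2\<close> times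
  \<open>1 / sqrt (n (1 - p))\<close>.
\<close>

lemma two_range_bound:
  "concentration (H \<star> conv_power F n) b
    \<le> 450000 * b / (\<sigma> * sqrt (real n * (1 - p))) *
         concentration (H \<star> conv_power V r) (\<sigma> * sqrt (real n))
     + few_bound * measure_pmf.prob (binomial_pmf n p) {\<mu>. \<mu> < r}"
proof -
  define D where "D = 300000 * b / \<sigma> * concentration (H \<star> conv_power V r) (\<sigma> * sqrt (real n))"
  have D: "0 \<le> D"
    using width_pos \<sigma>_pos unfolding D_def
    by (intro mult_nonneg_nonneg concentration_nonneg real_distribution_convolution
        real_distribution_conv_power H V) auto
  define g where "g \<mu> = D * (1 / sqrt (real (max 1 (n - \<mu>))))" for \<mu>
  define g3 where "g3 \<mu> = few_bound * indicator {\<mu>. \<mu> < r} \<mu>" for \<mu>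
  have "concentration (H \<star> conv_power F n) b \<le> measure_pmf.expectation (binomial_pmf n p) replaced"
    by (rule concentration_power_le)
  also have "\<dots> \<le> measure_pmf.expectation (binomial_pmf n p) (\<lambda>\<mu>. g \<mu> + g3 \<mu>)"
  proof (rule expectation_binomial_mono)
    fix k assume k: "k \<le> n"
    show "replaced k \<le> g k + g3 k"
    proof (cases "k < r")
      case True
      have "replaced k \<le> few_bound"
        using rs by (intro few_replacements_le H V True) auto
      moreover have "0 \<le> g k" using D by (simp add: g_def)
      moreover have "g3 k = few_bound" using True by (simp add: g3_def)
      ultimately show ?thesis by linarith
    next
      case False
      then have "replaced k \<le> g k"
        using many_replacements_le[OF H V, of r k] k by (simp add: g_def D_def)
      then show ?thesis using False by (simp add: g3_def)
    qed
  qed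
  also have "\<dots> = measure_pmf.expectation (binomial_pmf n p) g + measure_pmf.expectation (binomial_pmf n p) g3"
    by (simp add: integrable_binomial)
  also have "measure_pmf.expectation (binomial_pmf n p) g3
      = few_bound * measure_pmf.prob (binomial_pmf n p) {\<mu>. \<mu> < r}"
    unfolding g3_def by (subst integral_mult_right_zero) simp
  also have "measure_pmf.expectation (binomial_pmf n p) g
      = D * measure_pmf.expectation (binomial_pmf n p) (\<lambda>\<mu>. 1 / sqrt (real (max 1 (n - \<mu>))))"
    unfolding g_def by (rule integral_mult_right_zero)
  also have "\<dots> \<le> D * (3 / (2 * sqrt (real n * (1 - p))))"
    by (intro mult_left_mono expectation_inverse_sqrt_binomial_le p n_pos D)
  also have "\<dots> = 450000 * b / (\<sigma> * sqrt (real n * (1 - p))) *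
         concentration (H \<star> conv_power V r) (\<sigma> * sqrt (real n))"
    by (simp add: D_def)
  finally show ?thesis by simp
qed

end

theorem theorem1:
  shows "\<exists>c::real. c > 0 \<and>
    (\<forall>(n::nat) (p::real) (F::real measure) (U::real measure) (V::real measure) (H::real measure)
       (\<sigma>::real) (b::real) (r::nat) (s::nat).
      1 \<le> n \<longrightarrow> 0 < p \<longrightarrow> p < 1 \<longrightarrow>
      real_distribution F \<longrightarrow> real_distribution U \<longrightarrow>
      real_distribution V \<longrightarrow> real_distribution H \<longrightarrow>
      (\<forall>A\<in>sets borel. measure F A = (1 - p) * measure U A + p * measure V A) \<longrightarrow>
      integrable U (\<lambda>x. x\<^sup>2) \<longrightarrow> 0 < \<sigma> \<longrightarrow> \<sigma>\<^sup>2 = (LINT x|U. x\<^sup>2) \<longrightarrow>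
      (LINT x|U. x) = 0 \<longrightarrow>
      b \<ge> (LINT x|U. x\<^sup>2 * min \<bar>x\<bar> (\<sigma> * sqrt (real n))) / \<sigma>\<^sup>2 \<longrightarrow>
      r < s \<longrightarrow> s \<le> n \<longrightarrow>
      concentration (H \<star> conv_power F n) b
        \<le> measure_pmf.expectation (binomial_pmf n p) (\<lambda>\<mu>.
             c * b / (\<sigma> * sqrt (real (n - \<mu>))) *
             concentration (H \<star> conv_power V \<mu>) (\<sigma> * sqrt (real (n - \<mu>))) *
             indicator {r..<s} \<mu>)
         + measure_pmf.expectation (binomial_pmf n p) (\<lambda>\<mu>.
             concentration ((H \<star> conv_power U (n - \<mu>)) \<star> conv_power V \<mu>) b *
             indicator {s..} \<mu>)
         + min 1 (c * b / (\<sigma> * sqrt (real (n - r))) * concentration H (\<sigma> * sqrt (real n))) *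
           measure_pmf.prob (binomial_pmf n p) {\<mu>. \<mu> < r}
      \<and>
      concentration (H \<star> conv_power F n) b
        \<le> c * b / (\<sigma> * sqrt (real n * (1 - p))) *
             concentration (H \<star> conv_power V r) (\<sigma> * sqrt (real n))
         + min 1 (c * b / (\<sigma> * sqrt (real (n - r))) * concentration H (\<sigma> * sqrt (real n))) *
           measure_pmf.prob (binomial_pmf n p) {\<mu>. \<mu> < r})"
proof (intro exI[of _ 450000] conjI allI impI, goal_cases)
  case 1
  show ?case by simp
next
  case (2 n p F U V H \<sigma> b r s)
  then interpret mixture_summand U \<sigma> b n F V H p r s
    by (simp add: mixture_summand_def mixture_summand_axioms_def centred_summand_def
        centred_summand_axioms_def)
  show ?case by (rule three_range_bound)
next
  case (3 n p F U V H \<sigma> b r s)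
  then interpret mixture_summand U \<sigma> b n F V H p r s
    by (simp add: mixture_summand_def mixture_summand_axioms_def centred_summand_def
        centred_summand_axioms_def)
  show ?case by (rule two_range_bound)
qed

end
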